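(* The following assertion is false: "for every finite-dimensional complex simple Lie algebra $\mathfrak{g}$, every standard parabolic subalgebra $\mathfrak{p}\subset\mathfrak{g}$ of cominuscule type, and every reduced decomposition of the longest element $w_0$ of the Weyl group of $\mathfrak{g}$, the associated quantum root vectors satisfy $[E_\xi,F_{\xi'}]\in U_q(\mathfrak{l})$ for all radical roots $\xi,\xi'\in\Delta(\mathfrak{u}_+)$." That is, there exist such $\mathfrak{g}$ and $\mathfrak{p}$ (with Levi factor $\mathfrak{l}$), a reduced decomposition of $w_0$, and radical roots $\xi,\xi'\in\Delta(\mathfrak{u}_+)$, such that the quantum root vectors defined from this decomposition satisfy $[E_\xi,F_{\xi'}]\notin U_q(\mathfrak{l})$.
   Context: Let $\mathfrak{g}$ have Cartan subalgebra $\mathfrak{h}$, root system $\Delta(\mathfrak{g})$, positive roots $\Delta^+(\mathfrak{g})$, simple roots $\Pi=\{\alpha_1,\dots,\alpha_r\}$, Cartan matrix $(a_{ij})$ and the usual invariant form $(\cdot,\cdot)$; $s_i$ is the reflection in $\alpha_i$. Parabolics. For $S\subset\Pi$ put $\Delta(\mathfrak{l})=\mathrm{span}(S)\cap\Delta(\mathfrak{g})$, $\Delta^+(\mathfrak l)=\Delta(\mathfrak l)\cap\Delta^+(\mathfrak g)$, $\Delta(\mathfrak{u}_+)=\Delta^+(\mathfrak{g})\setminus\Delta^+(\mathfrak{l})$ (the radical roots), $\mathfrak{l}=\mathfrak{h}\oplus\bigoplus_{\alpha\in\Delta(\mathfrak{l})}\mathfrak{g}_\alpha$ (Levi factor), $\mathfrak{u}_\pm=\bigoplus_{\alpha\in\Delta(\mathfrak{u}_+)}\mathfrak{g}_{\pm\alpha}$,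 $\mathfrak{p}=\mathfrak{l}\oplus\mathfrak{u}_+$ (the standard parabolic subalgebra associated to $S$). $\mathfrak{p}$ is of cominuscule type if $\mathfrak{g}/\mathfrak{p}$ is a simple $\mathfrak{p}$-module; equivalently $S=\Pi\setminus\{\alpha_t\}$ where $\alpha_t$ has multiplicity $1$ in the highest root of $\mathfrak{g}$. Quantized enveloping algebra. Let $d_i=(\alpha_i,\alpha_i)/2$, $q\in\mathbb{C}$, $q_i=q^{d_i}$, where $q\neq 0$ is such that the denominators occurring below ($q_i-q_i^{-1}$ and the quantum factorials $[n]_{q_i}!$ with $n\le -a_{ij}$) are nonzero. $U_q(\mathfrak{g})$ is generated by $E_i,F_i,K_i^{\pm1}$ ($1\le i\le r$) with relations $K_iK_i^{-1}=K_i^{-1}K_i=1$, $K_iK_j=K_jK_i$, $K_iE_jK_i^{-1}=q_i^{a_{ij}}E_j$, $K_iF_jK_i^{-1}=q_i^{-a_{ij}}F_j$, $E_iF_j-F_jE_i=\delta_{ij}\frac{K_i-K_i^{-1}}{q_i-q_i^{-1}}$ and the quantum Serre relations. $U_q(\mathfrak{l})$ is the subalgebra of $U_q(\mathfrak{g})$ generated by all $K_i^{\pm1}$, $1\le i\le r$, and by the $E_j,F_j$ with $\alpha_j\in S$. Lusztig automorphisms. For $e=\pm1$: $T'_{i,e}(K_j)=K_jK_i^{-a_{ij}}$, $T'_{i,e}(E_i)=-K_i^{e}F_i$, $T'_{i,e}(F_i)=-E_iK_i^{-e}$, and for $j\ne i$, $T'_{i,e}(E_j)=\sum_{m+n=-a_{ij}}(-1)^m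 q_i^{em}E_i^{(m)}E_jE_i^{(n)}$, $T'_{i,e}(F_j)=\sum_{m+n=-a_{ij}}(-1)^m q_i^{-em}F_i^{(n)}F_jF_i^{(m)}$, with $X^{(m)}=X^m/[m]_{q_i}!$. Also $T''_{i,e}=\omega T'_{i,e}\omega^{-1}$, where $\omega$ is the algebra automorphism $E_i\mapsto F_i$, $F_i\mapsto E_i$, $K_i\mapsto K_i^{-1}$. $T_i$ denotes any fixed one of the four versions $T'_{i,\pm1},T''_{i,\pm1}$ (the same for all $i$). Quantum root vectors. For a reduced decomposition $w_0=s_{i_1}\cdots s_{i_N}$, the positive roots are $\beta_k=s_{i_1}\cdots s_{i_{k-1}}(\alpha_{i_k})$, $k=1,\dots,N$, and $E_{\beta_k}=T_{i_1}\cdots T_{i_{k-1}}(E_{i_k})$, $F_{\beta_k}=T_{i_1}\cdots T_{i_{k-1}}(F_{i_k})$. $[x,y]=xy-yx$. *)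

theory Defs
  imports Complex_Main "HOL-Library.FuncSet" "HOL-Library.Function_Algebras"
    "HOL-Library.Poly_Mapping"
begin

section \<open>Simple Lie algebras, root systems and parabolic subalgebras\<close>

locale complex_lie_algebra = vector_space scale
  for scale :: "complex \<Rightarrow> 'v::ab_group_add \<Rightarrow> 'v" (infixr \<open>*\<^sub>v\<close> 75) +
  fixes \<gg> :: "'v set" and bracket :: "'v \<Rightarrow> 'v \<Rightarrow> 'v" (\<open>\<lbrakk>_,/ _\<rbrakk>\<close>)
  assumes subspace_carrier: "subspace \<gg>"
    and finite_dim: "\<exists>B. finite B \<and> span B = \<gg>"
    and bracket_closed: "\<And>x y. x \<in> \<gg> \<Longrightarrow> y \<in> \<gg> \<Longrightarrow> \<lbrakk>x, y\<rbrakk> \<in> \<gg>"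
    and bracket_add_left:
      "\<And>x y z. x \<in> \<gg> \<Longrightarrow> y \<in> \<gg> \<Longrightarrow> z \<in> \<gg> \<Longrightarrow> \<lbrakk>x + y, z\<rbrakk> = \<lbrakk>x, z\<rbrakk> + \<lbrakk>y, z\<rbrakk>"
    and bracket_add_right:
      "\<And>x y z. x \<in> \<gg> \<Longrightarrow> y \<in> \<gg> \<Longrightarrow> z \<in> \<gg> \<Longrightarrow> \<lbrakk>x, y + z\<rbrakk> = \<lbrakk>x, y\<rbrakk> + \<lbrakk>x, z\<rbrakk>"
    and bracket_scale_left: "\<And>c x y. x \<in> \<gg> \<Longrightarrow> y \<in> \<gg> \<Longrightarrow> \<lbrakk>c *\<^sub>v x, y\<rbrakk> = c *\<^sub>v \<lbrakk>x, y\<rbrakk>"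
    and bracket_scale_right: "\<And>c x y. x \<in> \<gg> \<Longrightarrow> y \<in> \<gg> \<Longrightarrow> \<lbrakk>x, c *\<^sub>v y\<rbrakk> = c *\<^sub>v \<lbrakk>x, y\<rbrakk>"
    and bracket_self: "\<And>x. x \<in> \<gg> \<Longrightarrow> \<lbrakk>x, x\<rbrakk> = 0"
    and jacobi: "\<And>x y z. x \<in> \<gg> \<Longrightarrow> y \<in> \<gg> \<Longrightarrow> z \<in> \<gg> \<Longrightarrow>
      \<lbrakk>x, \<lbrakk>y, z\<rbrakk>\<rbrakk> + \<lbrakk>y, \<lbrakk>z, x\<rbrakk>\<rbrakk> + \<lbrakk>z, \<lbrakk>x, y\<rbrakk>\<rbrakk> = 0"
begin

definition lie_ideal :: "'v set \<Rightarrow> bool" where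
  "lie_ideal I \<longleftrightarrow> subspace I \<and> I \<subseteq> \<gg> \<and> (\<forall>x\<in>\<gg>. \<forall>y\<in>I. \<lbrakk>x, y\<rbrakk> \<in> I)"

definition simple_lie :: bool where
  "simple_lie \<longleftrightarrow> (\<exists>x\<in>\<gg>. \<exists>y\<in>\<gg>. \<lbrakk>x, y\<rbrakk> \<noteq> 0) \<and> (\<forall>I. lie_ideal I \<longrightarrow> I = {0} \<or> I = \<gg>)"

definition lie_subalgebra :: "'v set \<Rightarrow> bool" where
  "lie_subalgebra A \<longleftrightarrow> subspace A \<and> A \<subseteq> \<gg> \<and> (\<forall>x\<in>A. \<forall>y\<in>A. \<lbrakk>x, y\<rbrakk> \<in> A)"

primrec lower_central :: "'v set \<Rightarrow> nat \<Rightarrow> 'v set" where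
  "lower_central A 0 = A"
| "lower_central A (Suc n) = span {\<lbrakk>x, y\<rbrakk> |x y. x \<in> A \<and> y \<in> lower_central A n}"

definition nilpotent_lie :: "'v set \<Rightarrow> bool" where
  "nilpotent_lie A \<longleftrightarrow> (\<exists>n. lower_central A n = {0})"

definition cartan_subalgebra :: "'v set \<Rightarrow> bool" where
  "cartan_subalgebra A \<longleftrightarrow> lie_subalgebra A \<and> nilpotent_lie A \<and>
     {x \<in> \<gg>. \<forall>y\<in>A. \<lbrakk>x, y\<rbrakk> \<in> A} = A"

definition invariant_form :: "('v \<Rightarrow> 'v \<Rightarrow> complex) \<Rightarrow> bool" where
  "invariant_form \<kappa> \<longleftrightarrow>
     (\<forall>x\<in>\<gg>. \<forall>y\<in>\<gg>. \<kappa> x y = \<kappa> y x) \<and>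
     (\<forall>x\<in>\<gg>. \<forall>y\<in>\<gg>. \<forall>z\<in>\<gg>. \<kappa> (x + y) z = \<kappa> x z + \<kappa> y z) \<and>
     (\<forall>c. \<forall>x\<in>\<gg>. \<forall>y\<in>\<gg>. \<kappa> (c *\<^sub>v x) y = c * \<kappa> x y) \<and>
     (\<forall>x\<in>\<gg>. \<forall>y\<in>\<gg>. \<forall>z\<in>\<gg>. \<kappa> \<lbrakk>x, y\<rbrakk> z = \<kappa> x \<lbrakk>y, z\<rbrakk>) \<and>
     (\<forall>x\<in>\<gg>. (\<forall>y\<in>\<gg>. \<kappa> x y = 0) \<longrightarrow> x = 0)"

text \<open>Linear functionals on \<open>H\<close> are functions on the whole type that vanish outside \<open>H\<close>,
  so that two functionals agreeing on \<open>H\<close> are equal.\<close>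

definition dual_space :: "'v set \<Rightarrow> ('v \<Rightarrow> complex) set" where
  "dual_space H = {\<mu>. (\<forall>x\<in>H. \<forall>y\<in>H. \<mu> (x + y) = \<mu> x + \<mu> y) \<and>
     (\<forall>c. \<forall>x\<in>H. \<mu> (c *\<^sub>v x) = c * \<mu> x) \<and> (\<forall>x. x \<notin> H \<longrightarrow> \<mu> x = 0)}"

definition weight_space :: "'v set \<Rightarrow> ('v \<Rightarrow> complex) \<Rightarrow> 'v set" where
  "weight_space H \<mu> = {x \<in> \<gg>. \<forall>h\<in>H. \<lbrakk>h, x\<rbrakk> = \<mu> h *\<^sub>v x}"

definition root_system :: "'v set \<Rightarrow> ('v \<Rightarrow> complex) set" where
  "root_system H = {\<beta> \<in> dual_space H. \<beta> \<noteq> (\<lambda>_. 0) \<and> weight_space H \<beta> \<noteq> {0}}"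

text \<open>The form on the dual of \<open>H\<close> obtained from the form on \<open>H\<close> by transport along
  \<open>t \<mapsto> \<kappa> t\<close>.\<close>

definition dual_vector :: "('v \<Rightarrow> 'v \<Rightarrow> complex) \<Rightarrow> 'v set \<Rightarrow> ('v \<Rightarrow> complex) \<Rightarrow> 'v" where
  "dual_vector \<kappa> H \<mu> = (THE t. t \<in> H \<and> (\<forall>h\<in>H. \<kappa> t h = \<mu> h))"

definition dual_form ::
  "('v \<Rightarrow> 'v \<Rightarrow> complex) \<Rightarrow> 'v set \<Rightarrow> ('v \<Rightarrow> complex) \<Rightarrow> ('v \<Rightarrow> complex) \<Rightarrow> complex" where
  "dual_form \<kappa> H \<mu> \<nu> = \<kappa> (dual_vector \<kappa> H \<mu>) (dual_vector \<kappa> H \<nu>)"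

end

text \<open>On a simple Lie algebra a nondegenerate invariant symmetric form is unique up to a scalar;
  the last two assumptions fix the scalar by giving short roots squared length \<open>2\<close>, which makes all
  \<open>d\<^sub>i = (\<alpha>\<^sub>i, \<alpha>\<^sub>i) / 2\<close> positive integers.  The simple roots are \<open>\<alpha> 0, \<dots>, \<alpha> (r - 1)\<close>.\<close>

locale simple_lie_with_base = complex_lie_algebra scale \<gg> bracket
  for scale :: "complex \<Rightarrow> 'v::ab_group_add \<Rightarrow> 'v" (infixr \<open>*\<^sub>v\<close> 75)
    and \<gg> :: "'v set" and bracket :: "'v \<Rightarrow> 'v \<Rightarrow> 'v" (\<open>\<lbrakk>_,/ _\<rbrakk>\<close>) +
  fixes H :: "'v set" and \<kappa> :: "'v \<Rightarrow> 'v \<Rightarrow> complex"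
    and r :: nat and \<alpha> :: "nat \<Rightarrow> 'v \<Rightarrow> complex"
  assumes simple: simple_lie
    and cartan: "cartan_subalgebra H"
    and simple_roots: "\<And>i. i < r \<Longrightarrow> \<alpha> i \<in> root_system H"
    and simple_roots_independent:
      "\<And>c. (\<lambda>h. \<Sum>i<r. c i * \<alpha> i h) = (\<lambda>_. 0) \<Longrightarrow> \<forall>i<r. c i = 0"
    and root_combination: "\<And>\<beta>. \<beta> \<in> root_system H \<Longrightarrow> \<exists>n :: nat \<Rightarrow> nat.
      \<beta> = (\<lambda>h. \<Sum>i<r. of_nat (n i) * \<alpha> i h) \<or> \<beta> = (\<lambda>h. - (\<Sum>i<r. of_nat (n i) * \<alpha> i h))"
    and form: "invariant_form \<kappa>"
    and form_short_root: "\<exists>\<beta>\<in>root_system H. dual_form \<kappa> H \<beta> \<beta> = 2"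
    and form_root: "\<And>\<beta>. \<beta> \<in> root_system H \<Longrightarrow> Re (dual_form \<kappa> H \<beta> \<beta>) \<ge> 2"
begin

abbreviation root_form :: "('v \<Rightarrow> complex) \<Rightarrow> ('v \<Rightarrow> complex) \<Rightarrow> complex" where
  "root_form \<equiv> dual_form \<kappa> H"

definition positive_roots :: "('v \<Rightarrow> complex) set" where
  "positive_roots =
     {\<beta> \<in> root_system H. \<exists>n :: nat \<Rightarrow> nat. \<beta> = (\<lambda>h. \<Sum>i<r. of_nat (n i) * \<alpha> i h)}"

definition cartan_matrix :: "nat \<Rightarrow> nat \<Rightarrow> int" where
  "cartan_matrix i j =
     (THE n. of_int n = 2 * root_form (\<alpha> i) (\<alpha> j) / root_form (\<alpha> i) (\<alpha> i))"

definition symmetrizer :: "nat \<Rightarrow> nat" where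
  "symmetrizer i = (THE n. of_nat n = root_form (\<alpha> i) (\<alpha> i) / 2)"

text \<open>A set of simple roots is given by the set \<open>S\<close> of its indices.\<close>

definition levi_roots :: "nat set \<Rightarrow> ('v \<Rightarrow> complex) set" where
  "levi_roots S =
     {\<beta> \<in> root_system H. \<exists>c :: nat \<Rightarrow> complex. \<beta> = (\<lambda>h. \<Sum>i\<in>S. c i * \<alpha> i h)}"

definition radical_roots :: "nat set \<Rightarrow> ('v \<Rightarrow> complex) set" where
  "radical_roots S = positive_roots - levi_roots S"

definition levi_factor :: "nat set \<Rightarrow> 'v set" where
  "levi_factor S = span (H \<union> (\<Union>\<beta>\<in>levi_roots S. weight_space H \<beta>))"

definition nilradical :: "nat set \<Rightarrow> 'v set" where
  "nilradical S = span (\<Union>\<beta>\<in>radical_roots S. weight_space H \<beta>)"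

definition parabolic :: "nat set \<Rightarrow> 'v set" where
  "parabolic S = {x + y |x y. x \<in> levi_factor S \<and> y \<in> nilradical S}"

text \<open>Simplicity of the \<open>\<pp>\<close>-module \<open>\<gg>/\<pp>\<close>, for \<open>\<pp> = parabolic S\<close>: its submodules are the \<open>W/\<pp>\<close>
  with \<open>W\<close> a \<open>\<pp>\<close>-stable subspace between \<open>\<pp>\<close> and \<open>\<gg>\<close>.\<close>

definition cominuscule :: "nat set \<Rightarrow> bool" where
  "cominuscule S \<longleftrightarrow> parabolic S \<noteq> \<gg> \<and>
     (\<forall>W. subspace W \<and> parabolic S \<subseteq> W \<and> W \<subseteq> \<gg> \<and> (\<forall>x\<in>parabolic S. \<forall>w\<in>W. \<lbrakk>x, w\<rbrakk> \<in> W) \<longrightarrow>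
        W = parabolic S \<or> W = \<gg>)"

definition reflection :: "nat \<Rightarrow> ('v \<Rightarrow> complex) \<Rightarrow> ('v \<Rightarrow> complex)" where
  "reflection i \<mu> =
     (\<lambda>h. \<mu> h - 2 * root_form \<mu> (\<alpha> i) / root_form (\<alpha> i) (\<alpha> i) * \<alpha> i h)"

definition weyl_word :: "nat list \<Rightarrow> ('v \<Rightarrow> complex) \<Rightarrow> ('v \<Rightarrow> complex)" where
  "weyl_word is = restrict (foldr reflection is) (dual_space H)"

definition weyl_group :: "(('v \<Rightarrow> complex) \<Rightarrow> ('v \<Rightarrow> complex)) set" where
  "weyl_group = weyl_word ` lists {..<r}"

definition weyl_length :: "(('v \<Rightarrow> complex) \<Rightarrow> ('v \<Rightarrow> complex)) \<Rightarrow> nat" where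
  "weyl_length w = (LEAST n. \<exists>is\<in>lists {..<r}. length is = n \<and> weyl_word is = w)"

definition longest_element :: "(('v \<Rightarrow> complex) \<Rightarrow> ('v \<Rightarrow> complex)) \<Rightarrow> bool" where
  "longest_element w \<longleftrightarrow> w \<in> weyl_group \<and> (\<forall>w'\<in>weyl_group. weyl_length w' \<le> weyl_length w)"

definition reduced_decomposition ::
  "(('v \<Rightarrow> complex) \<Rightarrow> ('v \<Rightarrow> complex)) \<Rightarrow> nat list \<Rightarrow> bool" where
  "reduced_decomposition w is \<longleftrightarrow>
     is \<in> lists {..<r} \<and> weyl_word is = w \<and> length is = weyl_length w"

text \<open>Positions in a word are counted from \<open>0\<close>.\<close>

definition word_root :: "nat list \<Rightarrow> nat \<Rightarrow> ('v \<Rightarrow> complex)" where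
  "word_root is k = foldr reflection (take k is) (\<alpha> (is ! k))"

end

section \<open>Free associative algebras\<close>

text \<open>Words form a monoid under concatenation, written additively because multiplication of
  \<^typ>\<open>'a::monoid_add \<Rightarrow>\<^sub>0 'b::semiring_0\<close> is convolution with respect to \<open>+\<close>.\<close>

datatype 'a free_word = Word (letters: "'a list")

instantiation free_word :: (type) monoid_add
begin

definition zero_free_word :: "'a free_word" where
  "zero_free_word = Word []"

definition plus_free_word :: "'a free_word \<Rightarrow> 'a free_word \<Rightarrow> 'a free_word" where
  "plus_free_word u v = Word (letters u @ letters v)"

instance
  by standard (simp_all add: zero_free_word_def plus_free_word_def)

end

type_synonym 'a free_algebra = "'a free_word \<Rightarrow>\<^sub>0 complex"

definition scalar :: "complex \<Rightarrow> 'a free_algebra" where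
  "scalar c = Poly_Mapping.single 0 c"

definition var :: "'a \<Rightarrow> 'a free_algebra" where
  "var x = Poly_Mapping.single (Word [x]) 1"

text \<open>The algebra homomorphism that sends each \<open>var x\<close> to \<open>\<phi> x\<close>.\<close>

definition free_hom :: "('a \<Rightarrow> 'b free_algebra) \<Rightarrow> 'a free_algebra \<Rightarrow> 'b free_algebra" where
  "free_hom \<phi> x =
     (\<Sum>w\<in>Poly_Mapping.keys x. scalar (Poly_Mapping.lookup x w) * prod_list (map \<phi> (letters w)))"

inductive_set subalgebra_generated :: "'a free_algebra set \<Rightarrow> 'a free_algebra set"
  for G :: "'a free_algebra set" where
  generator: "x \<in> G \<Longrightarrow> x \<in> subalgebra_generated G"
| scalar: "scalar c \<in> subalgebra_generated G"
| add: "x \<in> subalgebra_generated G \<Longrightarrow> y \<in> subalgebra_generated G \<Longrightarrow>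
    x + y \<in> subalgebra_generated G"
| mult: "x \<in> subalgebra_generated G \<Longrightarrow> y \<in> subalgebra_generated G \<Longrightarrow>
    x * y \<in> subalgebra_generated G"

inductive_set ideal_generated ::
  "'a free_algebra set \<Rightarrow> 'a free_algebra set \<Rightarrow> 'a free_algebra set"
  for A R :: "'a free_algebra set" where
  zero: "0 \<in> ideal_generated A R"
| generator: "u \<in> A \<Longrightarrow> v \<in> A \<Longrightarrow> x \<in> R \<Longrightarrow> u * x * v \<in> ideal_generated A R"
| add: "x \<in> ideal_generated A R \<Longrightarrow> y \<in> ideal_generated A R \<Longrightarrow>
    x + y \<in> ideal_generated A R"

section \<open>Quantized enveloping algebras\<close>

definition q_int :: "complex \<Rightarrow> nat \<Rightarrow> complex" where
  "q_int v n = (v ^ n - inverse v ^ n) / (v - inverse v)"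

definition q_fact :: "complex \<Rightarrow> nat \<Rightarrow> complex" where
  "q_fact v n = (\<Prod>m=1..n. q_int v m)"

text \<open>Gaussian binomials are defined by the \<open>q\<close>-Pascal rule because \<open>q_fact v n\<close> may vanish for
  \<open>n = 1 - a\<^sub>i\<^sub>j\<close>, where they are still needed in the quantum Serre relations.\<close>

fun q_binomial :: "complex \<Rightarrow> nat \<Rightarrow> nat \<Rightarrow> complex" where
  "q_binomial v n 0 = 1"
| "q_binomial v 0 (Suc m) = 0"
| "q_binomial v (Suc n) (Suc m) =
     v ^ Suc m * q_binomial v n (Suc m) + inverse v ^ (n - m) * q_binomial v n m"

datatype uq_gen = E_gen nat | F_gen nat | K_gen nat | K_inv_gen nat

text \<open>The parameters are the rank \<open>r\<close>, the Cartan matrix \<open>a\<close>, the symmetrizing integers \<open>d\<close>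
  and \<open>q\<close>; generators have indices below \<open>r\<close>.\<close>

locale quantum_parameters =
  fixes r :: nat and a :: "nat \<Rightarrow> nat \<Rightarrow> int" and d :: "nat \<Rightarrow> nat" and q :: complex
begin

definition q_sub :: "nat \<Rightarrow> complex" where
  "q_sub i = q ^ d i"

definition admissible :: bool where
  "admissible \<longleftrightarrow> q \<noteq> 0 \<and> (\<forall>i<r. q_sub i - inverse (q_sub i) \<noteq> 0) \<and>
     (\<forall>i<r. \<forall>j<r. i \<noteq> j \<longrightarrow> (\<forall>n. int n \<le> - a i j \<longrightarrow> q_fact (q_sub i) n \<noteq> 0))"

abbreviation E :: "nat \<Rightarrow> uq_gen free_algebra" where "E i \<equiv> var (E_gen i)"
abbreviation F :: "nat \<Rightarrow> uq_gen free_algebra" where "F i \<equiv> var (F_gen i)"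
abbreviation K :: "nat \<Rightarrow> uq_gen free_algebra" where "K i \<equiv> var (K_gen i)"
abbreviation K_inv :: "nat \<Rightarrow> uq_gen free_algebra" where "K_inv i \<equiv> var (K_inv_gen i)"

definition K_pow :: "nat \<Rightarrow> int \<Rightarrow> uq_gen free_algebra" where
  "K_pow i n = (if n \<ge> 0 then K i ^ nat n else K_inv i ^ nat (- n))"

definition serre :: "(nat \<Rightarrow> uq_gen free_algebra) \<Rightarrow> nat \<Rightarrow> nat \<Rightarrow> uq_gen free_algebra" where
  "serre X i j = (let N = nat (1 - a i j) in
     \<Sum>m\<le>N. scalar ((-1) ^ m * q_binomial (q_sub i) N m) * X i ^ m * X j * X i ^ (N - m))"

definition relations :: "uq_gen free_algebra set" where
  "relations =
     {K i * K_inv i - 1 |i. i < r} \<union>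
     {K_inv i * K i - 1 |i. i < r} \<union>
     {K i * K j - K j * K i |i j. i < r \<and> j < r} \<union>
     {K i * E j * K_inv i - scalar (q_sub i powi a i j) * E j |i j. i < r \<and> j < r} \<union>
     {K i * F j * K_inv i - scalar (q_sub i powi (- a i j)) * F j |i j. i < r \<and> j < r} \<union>
     {E i * F j - F j * E i -
        (if i = j then scalar (1 / (q_sub i - inverse (q_sub i))) * (K i - K_inv i) else 0)
      |i j. i < r \<and> j < r} \<union>
     {serre E i j |i j. i < r \<and> j < r \<and> i \<noteq> j} \<union>
     {serre F i j |i j. i < r \<and> j < r \<and> i \<noteq> j}"

definition free_carrier :: "uq_gen free_algebra set" where
  "free_carrier = subalgebra_generated (E ` {..<r} \<union> F ` {..<r} \<union> K ` {..<r} \<union> K_inv ` {..<r})"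

text \<open>The class of \<open>x\<close> in the quotient \<open>U\<^sub>q(\<gg>)\<close> of the free algebra by the two-sided ideal
  generated by the relations.\<close>

definition uq_class :: "uq_gen free_algebra \<Rightarrow> uq_gen free_algebra set" where
  "uq_class x = {y \<in> free_carrier. y - x \<in> ideal_generated free_carrier relations}"

definition uq_levi :: "nat set \<Rightarrow> uq_gen free_algebra set set" where
  "uq_levi S = uq_class ` subalgebra_generated (K ` {..<r} \<union> K_inv ` {..<r} \<union> E ` S \<union> F ` S)"

text \<open>The automorphisms are represented by endomorphisms of the free algebra: a homomorphism out
  of \<open>U\<^sub>q(\<gg>)\<close> is determined by the images of the generators, so the class of \<open>T' e i x\<close> is the
  image of the class of \<open>x\<close> under the Lusztig automorphism \<open>T'\<^sub>i\<^sub>,\<^sub>e\<close>.\<close>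

definition divided_power :: "nat \<Rightarrow> uq_gen free_algebra \<Rightarrow> nat \<Rightarrow> uq_gen free_algebra" where
  "divided_power i x m = scalar (1 / q_fact (q_sub i) m) * x ^ m"

primrec T'_gen :: "int \<Rightarrow> nat \<Rightarrow> uq_gen \<Rightarrow> uq_gen free_algebra" where
  "T'_gen e i (K_gen j) = K j * K_pow i (- a i j)"
| "T'_gen e i (K_inv_gen j) = K_inv j * K_pow i (a i j)"
| "T'_gen e i (E_gen j) = (if j = i then - (K_pow i e * F i) else
     (let N = nat (- a i j) in
      \<Sum>m\<le>N. scalar ((-1) ^ m * q_sub i powi (e * int m)) *
        divided_power i (E i) m * E j * divided_power i (E i) (N - m)))"
| "T'_gen e i (F_gen j) = (if j = i then - (E i * K_pow i (- e)) else
     (let N = nat (- a i j) in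
      \<Sum>m\<le>N. scalar ((-1) ^ m * q_sub i powi (- (e * int m))) *
        divided_power i (F i) (N - m) * F j * divided_power i (F i) m))"

definition T' :: "int \<Rightarrow> nat \<Rightarrow> uq_gen free_algebra \<Rightarrow> uq_gen free_algebra" where
  "T' e i = free_hom (T'_gen e i)"

primrec omega_gen :: "uq_gen \<Rightarrow> uq_gen free_algebra" where
  "omega_gen (E_gen i) = F i"
| "omega_gen (F_gen i) = E i"
| "omega_gen (K_gen i) = K_inv i"
| "omega_gen (K_inv_gen i) = K i"

definition omega :: "uq_gen free_algebra \<Rightarrow> uq_gen free_algebra" where
  "omega = free_hom omega_gen"

definition T'' :: "int \<Rightarrow> nat \<Rightarrow> uq_gen free_algebra \<Rightarrow> uq_gen free_algebra" where
  "T'' e i = omega \<circ> T' e i \<circ> inv omega"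

definition lusztig_versions ::
  "(nat \<Rightarrow> uq_gen free_algebra \<Rightarrow> uq_gen free_algebra) set" where
  "lusztig_versions = {T' 1, T' (-1), T'' 1, T'' (-1)}"

end

definition E_root :: "(nat \<Rightarrow> uq_gen free_algebra \<Rightarrow> uq_gen free_algebra) \<Rightarrow>
    nat list \<Rightarrow> nat \<Rightarrow> uq_gen free_algebra" where
  "E_root T is k = foldr T (take k is) (var (E_gen (is ! k)))"

definition F_root :: "(nat \<Rightarrow> uq_gen free_algebra \<Rightarrow> uq_gen free_algebra) \<Rightarrow>
    nat list \<Rightarrow> nat \<Rightarrow> uq_gen free_algebra" where
  "F_root T is k = foldr T (take k is) (var (F_gen (is ! k)))"

definition commutator :: "'a::ring \<Rightarrow> 'a \<Rightarrow> 'a" where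
  "commutator x y = x * y - y * x"

text \<open>Every finite-dimensional complex vector space is isomorphic to a subspace of
  \<^typ>\<open>nat \<Rightarrow> complex\<close>, so Lie algebras carried by such subspaces cover all isomorphism
  classes.\<close>

definition seq_scale :: "complex \<Rightarrow> (nat \<Rightarrow> complex) \<Rightarrow> (nat \<Rightarrow> complex)" where
  "seq_scale c f = (\<lambda>n. c * f n)"

end

(* The counterexample is sl_4 with the middle simple root removed, the word [1, 2, 1, 0, 1, 2]
   (indices from 0) and the roots \<alpha>_1 + \<alpha>_2 and \<alpha>_0 + \<alpha>_1 + \<alpha>_2.  Here
   [E, F] = T_1 [E_2, T_2 T_1 F_0] is T_1 T_1 (F_0) times a scalar and a product of K's, and
   T_1 T_1 (F_0) contains the product of the root vector of -\<alpha>_0 - \<alpha>_1 with E_1.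

   To see that this is not in U_q(l) for any admissible q, roots of unity included, let U_q act on
   V \<otimes> V with V the vector representation.  With V_1 = <v_0, v_1> and V_2 = <v_2, v_3>, the
   subspace V_1 \<otimes> V_2 is stable under U_q(l), but the commutator maps v_0 \<otimes> v_2 to a vector
   whose coefficient at v_2 \<otimes> v_1 is, up to a sign and a power of q, equal to q^2 - 1. *)

theory Submission
  imports Defs
begin

text \<open>The commutator has weight -\<alpha>_0, which is a root of the Levi factor, so weights
  cannot separate it from U_q(l). Nor can V alone: the only matrix unit of this weight maps v_0 to
  v_1, just as F_0 does. Two tensor factors let the two non-Levi root vectors act on different
  factors, one sending v_0 to v_2 in the first, the other v_2 to v_1 in the second; Levi generators
  never carry an index across the two blocks. The effect is purely quantum: the coefficient q^2 - 1
  vanishes at q = 1, where the commutator is an ordinary root vector of the Levi factor.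
  Admissibility excludes q^2 = 1 because it asks for q - q^-1 to be nonzero. In the chosen word the
  Levi root \<alpha>_2 stands between the two radical roots, so the order of the positive roots is
  not adapted to the Levi factor. Since nonmembership is detected by an invariant subspace, the
  quotient enters only through the fact that the defining relations act by zero. The Lusztig maps
  are evaluated on representatives in the free algebra.\<close>

section \<open>Representations of free algebras\<close>

lemma free_algebra_induct [case_names zero single add]:
  fixes x :: "'a free_algebra"
  assumes "P 0" "\<And>w c. P (Poly_Mapping.single w c)" "\<And>x y. P x \<Longrightarrow> P y \<Longrightarrow> P (x + y)"
  shows "P x"
proof (induction x rule: update_induct)
  case const
  then show ?case using assms by simp
next
  case (update f a b)
  have "Poly_Mapping.update a b f = f + Poly_Mapping.single a b"
    using update(1)
    by (intro poly_mapping_eqI) (auto simp: lookup_update lookup_add lookup_single in_keys_iff)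
  then show ?case using assms update by simp
qed

lemma free_hom_single: "free_hom \<phi> (Poly_Mapping.single w c) = scalar c * prod_list (map \<phi> (letters w))"
  by (cases "c = 0") (simp_all add: free_hom_def scalar_def)

lemma free_hom_0 [simp]: "free_hom \<phi> 0 = 0"
  by (simp add: free_hom_def)

lemma scalar_add: "scalar (b + c) = scalar b + scalar c"
  by (simp add: scalar_def single_add)

lemma scalar_mult: "scalar (b * c) = scalar b * scalar c"
  by (simp add: scalar_def mult_single)

lemma scalar_simps [simp]: "scalar 0 = 0" "scalar 1 = 1" "scalar (- c) = - scalar c"
  by (simp_all add: scalar_def single_uminus)

lemma scalar_single: "scalar b * Poly_Mapping.single w c = Poly_Mapping.single w (b * c)"
  by (simp add: scalar_def mult_single)

lemma scalar_commute: "scalar c * x = x * scalar c"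
  by (induction x rule: free_algebra_induct)
    (simp_all add: algebra_simps scalar_def mult_single)

lemma free_hom_add [simp]: "free_hom \<phi> (x + y) = free_hom \<phi> x + free_hom \<phi> y"
  unfolding free_hom_def
  by (rule setsum_keys_plus_distrib) (simp_all add: scalar_add algebra_simps)

lemma letters_zero [simp]: "letters 0 = []"
  by (simp add: zero_free_word_def)

lemma letters_plus [simp]: "letters (u + v) = letters u @ letters v"
  by (simp add: plus_free_word_def)

lemma free_hom_mult [simp]: "free_hom \<phi> (x * y) = free_hom \<phi> x * free_hom \<phi> y"
proof (induction x rule: free_algebra_induct)
  case (single u b)
  show ?case
  proof (induction y rule: free_algebra_induct)
    case (single w c)
    let ?p = "prod_list (map \<phi> (letters u))"
    have "free_hom \<phi> (Poly_Mapping.single u b * Poly_Mapping.single w c)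
        = scalar b * (scalar c * ?p) * prod_list (map \<phi> (letters w))"
      by (simp add: mult_single free_hom_single scalar_mult mult.assoc)
    then show ?case
      by (simp only: scalar_commute[of c ?p]) (simp add: free_hom_single mult.assoc)
  qed (simp_all add: algebra_simps)
qed (simp_all add: algebra_simps)

lemma free_hom_scalar [simp]: "free_hom \<phi> (scalar c) = scalar c"
  unfolding scalar_def free_hom_single by (simp add: scalar_def)

lemma free_hom_1 [simp]: "free_hom \<phi> 1 = 1"
  using free_hom_scalar[of \<phi> 1] by simp

lemma free_hom_var [simp]: "free_hom \<phi> (var g) = \<phi> g"
  by (simp add: var_def free_hom_single)

lemma free_hom_uminus [simp]: "free_hom \<phi> (- x) = - free_hom \<phi> x"
  using free_hom_add[of \<phi> x "- x"] by (simp add: eq_neg_iff_add_eq_0 add.commute del: free_hom_add)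

lemma free_hom_diff [simp]: "free_hom \<phi> (x - y) = free_hom \<phi> x - free_hom \<phi> y"
  using free_hom_add[of \<phi> x "- y"] by (simp del: free_hom_add)

lemma prod_list_var: "prod_list (map var ws) = Poly_Mapping.single (Word ws) 1"
  by (induction ws)
    (simp_all add: var_def mult_single plus_free_word_def flip: single_one zero_free_word_def)

lemma free_hom_var_id: "free_hom var x = x"
  by (induction x rule: free_algebra_induct)
    (simp_all add: free_hom_single prod_list_var scalar_single)

lemma free_hom_free_hom: "free_hom \<phi> (free_hom \<psi> x) = free_hom (\<lambda>g. free_hom \<phi> (\<psi> g)) x"
proof (induction x rule: free_algebra_induct)
  case (single w c)
  have "free_hom \<phi> (prod_list (map \<psi> ws)) = prod_list (map (\<lambda>g. free_hom \<phi> (\<psi> g)) ws)" for ws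
    by (induction ws) simp_all
  then show ?case by (simp add: free_hom_single)
qed simp_all

section \<open>Free algebras acting on function spaces\<close>

definition linear_op :: "(('i \<Rightarrow> complex) \<Rightarrow> ('i \<Rightarrow> complex)) \<Rightarrow> bool" where
  "linear_op f \<longleftrightarrow> (\<forall>u v. f (u + v) = f u + f v) \<and> (\<forall>c v. f (\<lambda>i. c * v i) = (\<lambda>i. c * f v i))"

lemma linear_op_foldr: "(\<And>g. linear_op (\<rho> g)) \<Longrightarrow> linear_op (foldr \<rho> ws)"
  by (induction ws) (auto simp: linear_op_def)

text \<open>This makes sense for arbitrary maps \<rho> g; the linearity assumed in
  \<open>free_rep\<close> is what makes products act by composition.\<close>

definition act ::
  "('a \<Rightarrow> ('i \<Rightarrow> complex) \<Rightarrow> ('i \<Rightarrow> complex)) \<Rightarrow> 'a free_algebra \<Rightarrow> ('i \<Rightarrow> complex) \<Rightarrow> ('i \<Rightarrow> complex)"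
  where "act \<rho> x v =
    (\<Sum>w\<in>Poly_Mapping.keys x. (\<lambda>i. Poly_Mapping.lookup x w * foldr \<rho> (letters w) v i))"

lemma act_single: "act \<rho> (Poly_Mapping.single w c) v = (\<lambda>i. c * foldr \<rho> (letters w) v i)"
  by (cases "c = 0") (auto simp: act_def fun_eq_iff)

lemma act_0 [simp]: "act \<rho> 0 v = 0"
  by (simp add: act_def)

lemma act_add [simp]: "act \<rho> (x + y) v = act \<rho> x v + act \<rho> y v"
  unfolding act_def
  by (rule setsum_keys_plus_distrib) (auto simp: fun_eq_iff algebra_simps)

lemma act_uminus [simp]: "act \<rho> (- x) v = - act \<rho> x v"
  using act_add[of \<rho> x "- x"] by (simp add: eq_neg_iff_add_eq_0 add.commute del: act_add)

lemma act_diff [simp]: "act \<rho> (x - y) v = act \<rho> x v - act \<rho> y v"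
  using act_add[of \<rho> x "- y"] by (simp del: act_add)

lemma act_scalar [simp]: "act \<rho> (scalar c) v = (\<lambda>i. c * v i)"
  by (simp add: scalar_def act_single)

lemma act_1 [simp]: "act \<rho> 1 v = v"
  using act_scalar[of \<rho> 1] by simp

locale free_rep =
  fixes \<rho> :: "'a \<Rightarrow> ('i \<Rightarrow> complex) \<Rightarrow> ('i \<Rightarrow> complex)"
  assumes linear: "linear_op (\<rho> g)"
begin

lemma act_linear: "linear_op (act \<rho> x)"
proof (induction x rule: free_algebra_induct)
  case (single w c)
  show ?case using linear_op_foldr[of \<rho> "letters w"] linear
    by (auto simp: linear_op_def act_single algebra_simps)
qed (auto simp: linear_op_def fun_eq_iff algebra_simps)

lemma act_vec_0 [simp]: "act \<rho> x 0 = 0"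
  using act_linear[of x] unfolding linear_op_def by (metis add_cancel_right_right)

lemma act_var [simp]: "act \<rho> (var g) v = \<rho> g v"
  by (simp add: var_def act_single)

lemma act_mult [simp]: "act \<rho> (x * y) v = act \<rho> x (act \<rho> y v)"
proof (induction x rule: free_algebra_induct)
  case (single u b)
  have lin: "act \<rho> z (s + t) = act \<rho> z s + act \<rho> z t" "act \<rho> z (\<lambda>i. c * s i) = (\<lambda>i. c * act \<rho> z s i)"
    for z s t c using act_linear[of z] by (auto simp: linear_op_def)
  have lin': "foldr \<rho> ws (s + t) = foldr \<rho> ws s + foldr \<rho> ws t"
    "foldr \<rho> ws (\<lambda>i. c * s i) = (\<lambda>i. c * foldr \<rho> ws s i)" for ws s t c
    using linear_op_foldr[of \<rho> ws] linear by (auto simp: linear_op_def)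
  show ?case
  proof (induction y rule: free_algebra_induct)
    case zero
    show ?case by (simp only: mult_zero_right act_0 act_vec_0)
  next
    case (single w c)
    show ?case by (simp add: mult_single act_single lin' mult.assoc)
  next
    case (add y z)
    then show ?case by (simp only: distrib_left act_add lin)
  qed
qed (simp_all add: distrib_right)

text \<open>Elements that differ by a member of the ideal therefore act alike, so a class of the
  quotient has a well-defined action.\<close>

lemma act_ideal:
  assumes "x \<in> ideal_generated A R" and "\<And>y v. y \<in> R \<Longrightarrow> act \<rho> y v = 0"
  shows "act \<rho> x v = 0"
  using assms by (induction arbitrary: v) simp_all

lemma act_subalgebra:
  assumes "x \<in> subalgebra_generated G" and "v \<in> D"
    and "\<And>u w. u \<in> D \<Longrightarrow> w \<in> D \<Longrightarrow> u + w \<in> D" "\<And>c u. u \<in> D \<Longrightarrow> (\<lambda>i. c * u i) \<in> D"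
    and "\<And>y u. y \<in> G \<Longrightarrow> u \<in> D \<Longrightarrow> act \<rho> y u \<in> D"
  shows "act \<rho> x v \<in> D"
  using assms(1,2) by (induction arbitrary: v) (simp_all add: assms(3-))

end

lemma subalgebra_mono:
  assumes "x \<in> subalgebra_generated G" "G \<subseteq> G'"
  shows "x \<in> subalgebra_generated G'"
  using assms by induction (auto intro: subalgebra_generated.intros)

section \<open>A representation of the quantized enveloping algebra\<close>

text \<open>The eigenvalue of K_i on the basis vector v_a of V.\<close>

fun torus_weight :: "complex \<Rightarrow> nat \<Rightarrow> nat \<Rightarrow> complex" where
  "torus_weight q i a = (if a = i then q else if a = Suc i then inverse q else 1)"

text \<open>\<open>v (a, b)\<close> is the coefficient at \<open>v\<^sub>a \<otimes> v\<^sub>b\<close>.  The vector representation sends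
  \<open>E\<^sub>i\<close> to the matrix unit that maps \<open>v\<^sub>i\<^sub>+\<^sub>1\<close> to \<open>v\<^sub>i\<close>, and the coproduct is
  \<open>\<Delta> E = E \<otimes> 1 + K \<otimes> E\<close>, \<open>\<Delta> F = F \<otimes> K\<^sup>-\<^sup>1 + 1 \<otimes> F\<close>.\<close>

primrec tensor_rep ::
  "complex \<Rightarrow> uq_gen \<Rightarrow> (nat \<times> nat \<Rightarrow> complex) \<Rightarrow> (nat \<times> nat \<Rightarrow> complex)" where
  "tensor_rep q (E_gen i) v = (\<lambda>(a, b).
     (if a = i then v (Suc i, b) else 0) + (if b = i then torus_weight q i a * v (a, Suc i) else 0))"
| "tensor_rep q (F_gen i) v = (\<lambda>(a, b).
     (if a = Suc i then inverse (torus_weight q i b) * v (i, b) else 0) +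
     (if b = Suc i then v (a, i) else 0))"
| "tensor_rep q (K_gen i) v = (\<lambda>(a, b). torus_weight q i a * torus_weight q i b * v (a, b))"
| "tensor_rep q (K_inv_gen i) v =
     (\<lambda>(a, b). inverse (torus_weight q i a) * inverse (torus_weight q i b) * v (a, b))"

interpretation tensor_rep: free_rep "tensor_rep q"
  by standard (rename_tac g, case_tac g; auto simp: linear_op_def fun_eq_iff algebra_simps)

text \<open>The matrix \<open>a\<close> and the integers \<open>d\<close> stay parameters,
  constrained only at indices below 3, so that the Cartan matrix and symmetrizer computed from the
  Lie algebra can be substituted directly.\<close>

locale uq_A3 = quantum_parameters 3 a d q for a d q +
  assumes cartan: "\<And>i j. i < 3 \<Longrightarrow> j < 3 \<Longrightarrow>
      a i j = (if i = j then 2 else if i = Suc j \<or> j = Suc i then -1 else 0)"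
    and symmetrizer: "\<And>i. i < 3 \<Longrightarrow> d i = 1"
    and admissible: admissible
begin

lemma q_sub_eq: "i < 3 \<Longrightarrow> q_sub i = q"
  by (simp add: q_sub_def symmetrizer)

lemma q_nonzero: "q \<noteq> 0"
  using admissible by (simp add: admissible_def)

lemma q_inverse: "q - inverse q \<noteq> 0"
proof -
  have "q_sub 0 - inverse (q_sub 0) \<noteq> 0"
    using admissible by (simp add: admissible_def)
  then show ?thesis by (simp add: q_sub_eq)
qed

lemma q_neq_inverse: "q \<noteq> inverse q"
  using q_inverse by auto

lemma q_sq: "q * q \<noteq> 1"
  using q_inverse q_nonzero by (auto simp: field_simps)

text \<open>The only coefficient other than 1 and -1 comes from the Gaussian binomial of 2 over 1,
  which is q + q^-1.\<close>

lemma serre_eq: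
  assumes "i < 3" "j < 3" "i \<noteq> j"
  shows "serre X i j = (if i = Suc j \<or> j = Suc i
    then X j * X i * X i - scalar (q + inverse q) * X i * X j * X i + X i * X i * X j
    else X j * X i - X i * X j)"
  using assms
  by (simp add: serre_def cartan q_sub_eq Let_def eval_nat_numeral scalar_mult algebra_simps)

section \<open>The defining relations act by zero\<close>

lemma act_K_K_inv: "i < 3 \<Longrightarrow> act (tensor_rep q) (K i * K_inv i - 1) v = 0"
  "i < 3 \<Longrightarrow> act (tensor_rep q) (K_inv i * K i - 1) v = 0"
  by (auto simp: fun_eq_iff q_nonzero field_simps)

lemma act_K_K: "act (tensor_rep q) (K i * K j - K j * K i) v = 0"
  by (auto simp: fun_eq_iff)

lemma act_K_E: "i < 3 \<Longrightarrow> j < 3 \<Longrightarrow>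
  act (tensor_rep q) (K i * E j * K_inv i - scalar (q_sub i powi a i j) * E j) v = 0"
  by (auto simp: fun_eq_iff q_nonzero cartan q_sub_eq power_int_minus power2_eq_square field_simps)

lemma act_K_F: "i < 3 \<Longrightarrow> j < 3 \<Longrightarrow>
  act (tensor_rep q) (K i * F j * K_inv i - scalar (q_sub i powi (- a i j)) * F j) v = 0"
  by (auto simp: fun_eq_iff q_nonzero cartan q_sub_eq power_int_minus power2_eq_square field_simps)

lemma act_E_F:
  assumes "i < 3" "j < 3"
  shows "act (tensor_rep q) (E i * F j - F j * E i -
    (if i = j then scalar (1 / (q_sub i - inverse (q_sub i))) * (K i - K_inv i) else 0)) v = 0"
proof -
  \<comment> \<open>Clearing q^-1 reduces the denominator to q^2 - 1, whose nonvanishing is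
    \<open>q_sq\<close>.\<close>
  have "1 / (q - inverse q) = q / (q * q - 1)"
    using q_sq q_nonzero by (simp add: field_simps)
  then show ?thesis
    using assms q_sq q_nonzero
    by (auto simp: fun_eq_iff q_sub_eq divide_simps; simp add: algebra_simps)
qed

lemma act_serre: "i < 3 \<Longrightarrow> j < 3 \<Longrightarrow> i \<noteq> j \<Longrightarrow> act (tensor_rep q) (serre E i j) v = 0"
  "i < 3 \<Longrightarrow> j < 3 \<Longrightarrow> i \<noteq> j \<Longrightarrow> act (tensor_rep q) (serre F i j) v = 0"
  by (auto simp: fun_eq_iff q_nonzero serre_eq field_simps)

lemma relations_act:
  assumes "x \<in> relations"
  shows "act (tensor_rep q) x v = 0"
  using assms unfolding relations_def
  by (elim UnE CollectE exE conjE)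
    (simp_all only: act_K_K_inv act_K_K act_K_E act_K_F act_E_F act_serre simp_thms)

lemma act_relations_ideal:
  "x \<in> ideal_generated A relations \<Longrightarrow> act (tensor_rep q) x v = 0"
  by (rule tensor_rep.act_ideal) (auto intro: relations_act)

text \<open>Only the generators of index 1 move between the index blocks {0, 1} and {2, 3}. Indices
  run over all naturals, so V_2 here also holds the v_b with b at least 4; on these E_i and F_i with
  i < 3 give 0 and K_i is the identity.\<close>

definition levi_block :: "(nat \<times> nat \<Rightarrow> complex) set" where
  "levi_block = {v. \<forall>a b. 2 \<le> a \<or> b < 2 \<longrightarrow> v (a, b) = 0}"

text \<open>Membership in U_q(l) only provides some z in the Levi generators with the same class as
  x. As z lies in its own class, z - x is in the ideal, so x acts as z does, and z preserves the
  block.\<close>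

lemma uq_levi_block:
  assumes x: "uq_class x \<in> uq_levi {0, 2}" and v: "v \<in> levi_block"
  shows "act (tensor_rep q) x v \<in> levi_block"
proof -
  obtain z where z: "z \<in> subalgebra_generated (K ` {..<3} \<union> K_inv ` {..<3} \<union> E ` {0, 2} \<union> F ` {0, 2})"
    and eq: "uq_class x = uq_class z"
    using x unfolding uq_levi_def by blast
  have "z \<in> free_carrier"
    unfolding free_carrier_def by (rule subalgebra_mono[OF z]) auto
  then have "z \<in> uq_class z"
    by (simp add: uq_class_def ideal_generated.zero)
  then have "z - x \<in> ideal_generated free_carrier relations"
    by (simp add: eq[symmetric]) (simp add: uq_class_def)
  then have "act (tensor_rep q) (z - x) v = 0"
    by (rule act_relations_ideal)
  then have "act (tensor_rep q) x v = act (tensor_rep q) z v"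
    by simp
  also have "\<dots> \<in> levi_block"
    using z v
  proof (rule tensor_rep.act_subalgebra)
    fix y u assume "y \<in> K ` {..<3} \<union> K_inv ` {..<3} \<union> E ` {0, 2} \<union> F ` {0, 2}"
      and "u \<in> levi_block"
    then show "act (tensor_rep q) y u \<in> levi_block"
      by (auto simp: levi_block_def split: if_splits)
  qed (auto simp: levi_block_def)
  finally show ?thesis .
qed

text \<open>Off the diagonal the Cartan entries are 0 or -1, so only divided powers of exponent at
  most 1 occur. They equal ordinary powers because [1]! = 1, which uses q \<noteq> q^-1: otherwise
  the quotient defining [1] would be 0 / 0 = 0.\<close>

lemma T'_gen_A3:
  assumes "i < 3" "j < 3"
  shows "T'_gen e i (K_gen j) = (if i = j then K j * K_inv i * K_inv i
      else if i = Suc j \<or> j = Suc i then K j * K i else K j)"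
    "T'_gen e i (K_inv_gen j) = (if i = j then K_inv j * K i * K i
      else if i = Suc j \<or> j = Suc i then K_inv j * K_inv i else K_inv j)"
    "T'_gen e i (E_gen j) = (if i = j then - (K_pow i e * F i)
      else if i = Suc j \<or> j = Suc i then E j * E i - scalar (q powi e) * E i * E j else E j)"
    "T'_gen e i (F_gen j) = (if i = j then - (E i * K_pow i (- e))
      else if i = Suc j \<or> j = Suc i then F i * F j - scalar (q powi (- e)) * F j * F i else F j)"
  using assms
  by (auto simp: q_neq_inverse cartan q_sub_eq K_pow_def divided_power_def q_fact_def q_int_def Let_def
      power2_eq_square mult.assoc eval_nat_numeral)

text \<open>Already on the free algebra, before any relation is imposed, omega is an involution;
  hence the \<open>inv omega\<close> in the definition of \<open>T''\<close> is omega
  itself.\<close>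

lemma omega_omega: "omega (omega x) = x"
proof -
  have "free_hom omega_gen (omega_gen g) = var g" for g
    by (cases g) simp_all
  then show ?thesis by (simp add: omega_def free_hom_free_hom free_hom_var_id)
qed

lemma inv_omega: "inv omega = omega"
  by (rule inv_unique_comp) (auto simp: omega_omega)

text \<open>The start vector v_0 \<otimes> v_2 lies in \<open>levi_block\<close>, while the position
  (2, 1) is one where its members vanish. The first value serves the maps T', the second, with E and
  F exchanged, the maps T''.\<close>

lemma T'_witness:
  fixes v :: "nat \<times> nat \<Rightarrow> complex"
  assumes e: "e = 1 \<or> e = - 1" and v: "v = (\<lambda>ab. if ab = (0, 2) then 1 else 0)"
  shows "act (tensor_rep q) (commutator (T' e 1 (E 2)) (T' e 1 (T' e 2 (T' e 1 (F 0))))) v (2, 1) =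
      (if e = 1 then 1 - q * q else 1 - inverse (q * q))"
    and "act (tensor_rep q) (omega (commutator (T' e 1 (F 2)) (T' e 1 (T' e 2 (T' e 1 (E 0)))))) v (2, 1) =
      (if e = 1 then q * (q * q - 1) else (1 - q * q) / (q * q * q))"
  using e unfolding commutator_def T'_def omega_def v
  by (auto simp: T'_gen_A3 K_pow_def q_nonzero field_simps simp del: One_nat_def T'_gen.simps)

lemma commutator_notin_levi:
  assumes T: "T \<in> lusztig_versions"
  defines "is \<equiv> [1, 2, 1, 0, 1, 2]"
  shows "uq_class (commutator (E_root T is 1) (F_root T is 3)) \<notin> uq_levi {0, 2}"
proof
  define v :: "nat \<times> nat \<Rightarrow> complex" where "v = (\<lambda>ab. if ab = (0, 2) then 1 else 0)"
  let ?x = "commutator (E_root T is 1) (F_root T is 3)"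
  assume "uq_class ?x \<in> uq_levi {0, 2}"
  moreover have "v \<in> levi_block"
    by (simp add: v_def levi_block_def)
  ultimately have "act (tensor_rep q) ?x v (2, 1) = 0"
    using uq_levi_block unfolding levi_block_def by blast
  moreover have "?x = commutator (T 1 (E 2)) (T 1 (T 2 (T 1 (F 0))))"
    by (simp add: is_def E_root_def F_root_def numeral_eq_Suc)
  ultimately have 0: "act (tensor_rep q) (commutator (T 1 (E 2)) (T 1 (T 2 (T 1 (F 0))))) v (2, 1) = 0"
    by simp
  obtain e where e: "e = 1 \<or> e = - 1" and "T = T' e \<or> T = T'' e"
    using T unfolding lusztig_versions_def by blast
  from this(2) show False
  proof
    assume "T = T' e"
    then show False
      using 0 T'_witness(1)[OF e v_def] q_sq q_nonzero by (auto simp: field_simps split: if_splits)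
  next
    assume "T = T'' e"
    \<comment> \<open>In a composition of maps omega T' omega the inner omegas cancel; the innermost
      one exchanges E and F, and the outermost one factors out of the commutator.\<close>
    then have "commutator (T 1 (E 2)) (T 1 (T 2 (T 1 (F 0)))) =
        omega (commutator (T' e 1 (F 2)) (T' e 1 (T' e 2 (T' e 1 (E 0)))))"
      by (simp add: T''_def inv_omega omega_omega commutator_def) (simp add: omega_def)
    then show False
      using 0 T'_witness(2)[OF e v_def] q_sq q_nonzero by (auto split: if_splits)
  qed
qed
end

section \<open>The Lie algebra of traceless matrices of size four\<close>

text \<open>A 4 by 4 matrix is stored row by row in the first 16 terms of a sequence, because the
  Lie algebra has to be carried by a subspace of \<open>nat => complex\<close>.\<close>

definition entry :: "(nat \<Rightarrow> complex) \<Rightarrow> nat \<Rightarrow> nat \<Rightarrow> complex" where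
  "entry f i j = f (4 * i + j)"

definition of_entries :: "(nat \<Rightarrow> nat \<Rightarrow> complex) \<Rightarrow> nat \<Rightarrow> complex" where
  "of_entries m n = (if n < 16 then m (n div 4) (n mod 4) else 0)"

definition mat4 :: "(nat \<Rightarrow> complex) set" where
  "mat4 = {f. \<forall>n\<ge>16. f n = 0}"

definition sl4 :: "(nat \<Rightarrow> complex) set" where
  "sl4 = {f \<in> mat4. (\<Sum>i<4. entry f i i) = 0}"

definition sl4_bracket :: "(nat \<Rightarrow> complex) \<Rightarrow> (nat \<Rightarrow> complex) \<Rightarrow> (nat \<Rightarrow> complex)" where
  "sl4_bracket f g =
     of_entries (\<lambda>i j. \<Sum>k<4. entry f i k * entry g k j - entry g i k * entry f k j)"

definition unit4 :: "nat \<Rightarrow> nat \<Rightarrow> nat \<Rightarrow> complex" where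
  "unit4 i j = of_entries (\<lambda>k l. if k = i \<and> l = j then 1 else 0)"

definition diagonal4 :: "(nat \<Rightarrow> complex) set" where
  "diagonal4 = {f \<in> sl4. \<forall>i<4. \<forall>j<4. i \<noteq> j \<longrightarrow> entry f i j = 0}"

lemma less_4_cases: "i < 4 \<longleftrightarrow> i = 0 \<or> i = 1 \<or> i = 2 \<or> i = (3::nat)"
  by auto

lemma sum_less_4: "(\<Sum>k<4. f k) = f 0 + f 1 + f 2 + f (3::nat)"
  by (simp add: numeral_eq_Suc)

lemma entry_of_entries [simp]: "i < 4 \<Longrightarrow> j < 4 \<Longrightarrow> entry (of_entries m) i j = m i j"
  by (simp add: entry_def of_entries_def)

lemma of_entries_mat4 [simp]: "of_entries m \<in> mat4"
  by (simp add: of_entries_def mat4_def)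

lemma mat4_eqI:
  assumes "f \<in> mat4" "g \<in> mat4" "\<And>i j. i < 4 \<Longrightarrow> j < 4 \<Longrightarrow> entry f i j = entry g i j"
  shows "f = g"
proof
  fix n
  show "f n = g n"
  proof (cases "n < 16")
    case True
    then have "entry f (n div 4) (n mod 4) = entry g (n div 4) (n mod 4)"
      by (intro assms) auto
    then show ?thesis by (simp add: entry_def)
  qed (use assms(1,2) in \<open>simp add: mat4_def\<close>)
qed

lemma entry_linear [simp]:
  "entry 0 i j = 0" "entry (f + g) i j = entry f i j + entry g i j"
  "entry (f - g) i j = entry f i j - entry g i j" "entry (- f) i j = - entry f i j"
  "entry (seq_scale c f) i j = c * entry f i j"
  by (simp_all add: entry_def seq_scale_def)

lemma entry_sum: "entry (sum h A) i j = (\<Sum>a\<in>A. entry (h a) i j)"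
  by (induction A rule: infinite_finite_induct) (simp_all add: entry_def)

lemma mat4_linear [simp]:
  "0 \<in> mat4" "f \<in> mat4 \<Longrightarrow> g \<in> mat4 \<Longrightarrow> f + g \<in> mat4"
  "f \<in> mat4 \<Longrightarrow> g \<in> mat4 \<Longrightarrow> f - g \<in> mat4" "f \<in> mat4 \<Longrightarrow> - f \<in> mat4"
  "f \<in> mat4 \<Longrightarrow> seq_scale c f \<in> mat4"
  by (simp_all add: mat4_def seq_scale_def)

lemma bracket_mat4 [simp]: "sl4_bracket f g \<in> mat4"
  by (simp add: sl4_bracket_def)

lemma entry_bracket:
  "i < 4 \<Longrightarrow> j < 4 \<Longrightarrow> entry (sl4_bracket f g) i j =
     (\<Sum>k<4. entry f i k * entry g k j - entry g i k * entry f k j)"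
  by (simp add: sl4_bracket_def)

lemma unit4_mat4 [simp]: "unit4 i j \<in> mat4"
  by (simp add: unit4_def)

lemma entry_unit4 [simp]: "k < 4 \<Longrightarrow> l < 4 \<Longrightarrow> entry (unit4 i j) k l = (if k = i \<and> l = j then 1 else 0)"
  by (simp add: unit4_def)

lemma entry_bracket_unit4 [simp]:
  assumes "i < 4" "j < 4" "k < 4" "l < 4"
  shows "entry (sl4_bracket (unit4 i j) f) k l =
    (if k = i then entry f j l else 0) - (if l = j then entry f k i else 0)"
    "entry (sl4_bracket f (unit4 i j)) k l =
    (if l = j then entry f k i else 0) - (if k = i then entry f j l else 0)"
  using assms by (auto simp: entry_bracket sum_less_4 less_4_cases[of i] less_4_cases[of j])

lemma bracket_uminus: "sl4_bracket (- f) g = - sl4_bracket f g"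
  by (rule mat4_eqI) (auto simp: entry_bracket sum_less_4)

lemma sl4_mat4: "f \<in> sl4 \<Longrightarrow> f \<in> mat4"
  by (simp add: sl4_def)

lemma unit4_sl4 [simp]: "i \<noteq> j \<Longrightarrow> unit4 i j \<in> sl4"
  by (auto simp: sl4_def intro!: sum.neutral)

lemma diff_unit4_diagonal4 [simp]:
  "i < 4 \<Longrightarrow> j < 4 \<Longrightarrow> unit4 i i - unit4 j j \<in> diagonal4"
  by (auto simp: diagonal4_def sl4_def sum_less_4 less_4_cases)

lemma diagonal4_sl4: "f \<in> diagonal4 \<Longrightarrow> f \<in> sl4"
  by (simp add: diagonal4_def)

lemma bracket_sl4 [simp]: "sl4_bracket f g \<in> sl4"
  by (simp add: sl4_def) (simp add: entry_bracket sum_less_4 algebra_simps)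

text \<open>The associative product behind the bracket: both the Jacobi identity and the invariance
  of the trace form are reduced to its associativity.\<close>

definition mult4 :: "(nat \<Rightarrow> complex) \<Rightarrow> (nat \<Rightarrow> complex) \<Rightarrow> (nat \<Rightarrow> complex)" where
  "mult4 f g = of_entries (\<lambda>i j. \<Sum>k<4. entry f i k * entry g k j)"

lemma mult4_mat4 [simp]: "mult4 f g \<in> mat4"
  by (simp add: mult4_def)

lemma mult4_diff: "mult4 (f - g) h = mult4 f h - mult4 g h" "mult4 f (g - h) = mult4 f g - mult4 f h"
  by (rule mat4_eqI; simp add: mult4_def algebra_simps sum_subtractf)+

lemma mult4_assoc: "mult4 (mult4 f g) h = mult4 f (mult4 g h)"
  by (rule mat4_eqI) (simp_all, simp add: mult4_def sum_less_4 algebra_simps)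

lemma bracket_mult4: "sl4_bracket f g = mult4 f g - mult4 g f"
  by (rule mat4_eqI) (simp_all add: mult4_def entry_bracket sum_subtractf)

lemma bracket_jacobi:
  "sl4_bracket x (sl4_bracket y z) + sl4_bracket y (sl4_bracket z x) + sl4_bracket z (sl4_bracket x y) = 0"
  unfolding bracket_mult4 mult4_diff mult4_assoc by (simp add: algebra_simps)

section \<open>Traceless matrices as a finite-dimensional Lie algebra\<close>

interpretation seq: vector_space seq_scale
  by standard (auto simp: seq_scale_def fun_eq_iff algebra_simps)

lemma subspace_sl4: "seq.subspace sl4"
  by (auto simp: seq.subspace_def sl4_def sum.distrib simp flip: sum_distrib_left)

lemma subspace_diagonal4: "seq.subspace diagonal4"
  using subspace_sl4 by (auto simp: seq.subspace_def diagonal4_def)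

definition diagonal_part :: "(nat \<Rightarrow> complex) \<Rightarrow> nat \<Rightarrow> complex" where
  "diagonal_part f = of_entries (\<lambda>i j. if i = j then entry f i j else 0)"

lemma diagonal_part_diagonal4: "f \<in> sl4 \<Longrightarrow> diagonal_part f \<in> diagonal4"
  by (auto simp: diagonal4_def sl4_def diagonal_part_def)

text \<open>The diagonal is treated as one piece because a single diagonal matrix unit is not
  traceless. This is the common way to show that a subspace is all of sl_4 or contains a prescribed
  block.\<close>

lemma mem_subspace_from_entries:
  assumes f: "f \<in> mat4" and W: "seq.subspace W"
    and diag: "diagonal_part f \<in> W"
    and off: "\<And>i j. i < 4 \<Longrightarrow> j < 4 \<Longrightarrow> i \<noteq> j \<Longrightarrow> entry f i j \<noteq> 0 \<Longrightarrow> unit4 i j \<in> W"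
  shows "f \<in> W"
proof -
  define t where "t i j = (if i = j then 0 else seq_scale (entry f i j) (unit4 i j))" for i j
  have t: "t i j \<in> W" if "i < 4" "j < 4" for i j
  proof (cases "i = j \<or> entry f i j = 0")
    case True
    then show ?thesis using W by (auto simp: t_def seq.subspace_0)
  next
    case False
    then show ?thesis using that off W by (simp add: t_def seq.subspace_scale)
  qed
  have "(\<Sum>i<4. \<Sum>j<4. t i j) \<in> W"
    using t by (intro seq.subspace_sum[OF W]) auto
  moreover have "f = diagonal_part f + (\<Sum>i<4. \<Sum>j<4. t i j)"
  proof (rule mat4_eqI)
    have tm: "t i j \<in> mat4" for i j by (simp add: t_def)
    then show "diagonal_part f + (\<Sum>i<4. \<Sum>j<4. t i j) \<in> mat4"
      by (simp add: diagonal_part_def sum_less_4)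
    fix k l :: nat assume "k < 4" "l < 4"
    then have "entry (t i j) k l = (if j = l then if i = k then if k = l then 0 else entry f k l else 0 else 0)"
      if "i < 4" "j < 4" for i j using that by (simp add: t_def)
    then show "entry f k l = entry (diagonal_part f + (\<Sum>i<4. \<Sum>j<4. t i j)) k l"
      using \<open>k < 4\<close> \<open>l < 4\<close> by (simp add: diagonal_part_def entry_sum)
  qed (rule f)
  ultimately show ?thesis
    using seq.subspace_add[OF W diag] by metis
qed

lemma diagonal4_mem_subspace:
  assumes f: "f \<in> diagonal4" and W: "seq.subspace W"
    and D: "\<And>i. i < 3 \<Longrightarrow> unit4 i i - unit4 (Suc i) (Suc i) \<in> W"
  shows "f \<in> W"
proof -
  \<comment> \<open>Summation by parts: the coefficients are the partial sums of the diagonal of f,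
    and the full sum is the trace, which is 0.\<close>
  define g where "g = seq_scale (entry f 0 0) (unit4 0 0 - unit4 1 1)
    + seq_scale (entry f 0 0 + entry f 1 1) (unit4 1 1 - unit4 2 2)
    + seq_scale (entry f 0 0 + entry f 1 1 + entry f 2 2) (unit4 2 2 - unit4 3 3)"
  have "g \<in> W"
    using D[of 0] D[of 1] D[of 2] unfolding g_def
    by (intro seq.subspace_add[OF W] seq.subspace_scale[OF W]) (simp_all add: numeral_eq_Suc)
  moreover have "f = g"
  proof (rule mat4_eqI)
    fix k l :: nat assume kl: "k < 4" "l < 4"
    have trace: "entry f 0 0 + entry f 1 1 + entry f 2 2 + entry f 3 3 = 0"
      using f by (simp add: diagonal4_def sl4_def sum_less_4)
    show "entry f k l = entry g k l"
    proof (cases "k = l")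
      case True
      moreover have "entry f 3 3 = - (entry f 0 0 + entry f 1 1 + entry f 2 2)"
        using trace by (metis eq_neg_iff_add_eq_0 add.commute)
      ultimately show ?thesis
        using kl(1) less_4_cases[THEN iffD1, OF kl(2)] by (elim disjE) (simp_all add: g_def)
    next
      case False
      then show ?thesis
        using kl f by (auto simp: g_def diagonal4_def)
    qed
  qed (use f in \<open>simp_all add: g_def diagonal4_def sl4_def\<close>)
  ultimately show ?thesis by simp
qed

text \<open>The sixteen matrix units span too much, since the diagonal ones are outside sl_4. They
  bound the size of an independent set, so a basis chosen inside sl_4 is finite.\<close>

lemma finite_dim_sl4: "\<exists>B. finite B \<and> seq.span B = sl4"
proof -
  define U where "U = (\<lambda>(i, j). unit4 i j) ` ({..<4} \<times> {..<4})"
  have U: "unit4 i j \<in> seq.span U" if "i < 4" "j < 4" for i j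
    using that by (intro seq.span_base) (auto simp: U_def)
  have "sl4 \<subseteq> seq.span U"
  proof
    fix f assume f: "f \<in> sl4"
    show "f \<in> seq.span U"
    proof (rule mem_subspace_from_entries)
      show "diagonal_part f \<in> seq.span U"
        using diagonal_part_diagonal4[OF f]
      proof (rule diagonal4_mem_subspace)
        fix i :: nat assume "i < 3"
        then show "unit4 i i - unit4 (Suc i) (Suc i) \<in> seq.span U"
          by (intro seq.span_diff U) auto
      qed simp
    qed (use f U in \<open>auto simp: sl4_def\<close>)
  qed
  moreover obtain B where "B \<subseteq> sl4" "seq.independent B" "sl4 \<subseteq> seq.span B"
    using seq.basis_exists by metis
  moreover have "finite U" by (simp add: U_def)
  ultimately have "finite B" "seq.span B = sl4"
    using seq.independent_span_bound[of U B] seq.span_minimal[of B sl4] subspace_sl4 by auto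
  then show ?thesis by blast
qed

interpretation sl4: complex_lie_algebra seq_scale sl4 sl4_bracket
proof
  show "seq.subspace sl4" by (rule subspace_sl4)
  show "\<exists>B. finite B \<and> seq.span B = sl4" by (rule finite_dim_sl4)
  fix x show "sl4_bracket x x = 0"
    by (rule mat4_eqI) (simp_all add: entry_bracket)
next
  fix x y z show "sl4_bracket (x+y) z = sl4_bracket x z + sl4_bracket y z"
    by (rule mat4_eqI) (simp_all add: entry_bracket sum_less_4 algebra_simps)
next
  fix x y z show "sl4_bracket x (y+z) = sl4_bracket x y + sl4_bracket x z"
    by (rule mat4_eqI) (simp_all add: entry_bracket sum_less_4 algebra_simps)
next
  fix c x y show "sl4_bracket (seq_scale c x) y = seq_scale c (sl4_bracket x y)"
    by (rule mat4_eqI) (simp_all add: entry_bracket sum_less_4 algebra_simps)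
next
  fix c x y show "sl4_bracket x (seq_scale c y) = seq_scale c (sl4_bracket x y)"
    by (rule mat4_eqI) (simp_all add: entry_bracket sum_less_4 algebra_simps)
qed (auto simp: bracket_jacobi)

section \<open>Simplicity\<close>

lemma sl4_ideal_unit:
  assumes I: "sl4.lie_ideal I" and ij: "i < 4" "j < 4" "i \<noteq> j" "unit4 i j \<in> I"
  shows "I = sl4"
proof -
  have sub: "seq.subspace I" and "I \<subseteq> sl4"
    and br: "\<And>x y. x \<in> sl4 \<Longrightarrow> y \<in> I \<Longrightarrow> sl4_bracket x y \<in> I"
    using I by (auto simp: sl4.lie_ideal_def)
  have row: "unit4 k l \<in> I" if "unit4 i l \<in> I" "i < 4" "k < 4" "l < 4" "i \<noteq> l" "k \<noteq> l" for i k l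
  proof (cases "k = i")
    case False
    then have "unit4 k l = sl4_bracket (unit4 k i) (unit4 i l)"
      using that by (intro mat4_eqI) auto
    then show ?thesis using that br[of "unit4 k i" "unit4 i l"] False by simp
  qed (use that in simp)
  have col: "unit4 k l \<in> I" if "unit4 k j \<in> I" "j < 4" "k < 4" "l < 4" "k \<noteq> l" "k \<noteq> j" for j k l
  proof (cases "l = j")
    case False
    then have "unit4 k l = sl4_bracket (- unit4 j l) (unit4 k j)"
      using that by (intro mat4_eqI) (auto simp: bracket_uminus)
    then show ?thesis
      using that br[of "- unit4 j l" "unit4 k j"] False seq.subspace_neg[OF subspace_sl4] by simp
  qed (use that in simp)
  have U: "unit4 k l \<in> I" if "k < 4" "l < 4" "k \<noteq> l" for k l
  proof -
    \<comment> \<open>For k = j, moving the row of E_ij to k would produce the diagonal unit E_jj. A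
      row m different from j and l gives a detour: E_mj, then E_ml, then E_kl.\<close>
    have "\<exists>m<3. m \<noteq> j \<and> m \<noteq> l"
      by presburger
    then obtain m where m: "m < 3" "m \<noteq> j" "m \<noteq> l"
      by blast
    then have "m < 4" by simp
    show ?thesis
    proof (cases "k = j")
      case True
      have "unit4 m j \<in> I"
        using row[of i j m] m \<open>m < 4\<close> ij by simp
      then have "unit4 m l \<in> I"
        using col[of m j l] m \<open>m < 4\<close> ij that by simp
      then show ?thesis
        using row[of m l k] m \<open>m < 4\<close> that by simp
    next
      case False
      have "unit4 k j \<in> I"
        using row[of i j k] that ij False by simp
      then show ?thesis
        using col[of k j l] that ij False by simp
    qed
  qed
  have D: "unit4 k k - unit4 l l \<in> I" if "k < 4" "l < 4" "k \<noteq> l" for k l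
  proof -
    have "unit4 k k - unit4 l l = sl4_bracket (unit4 k l) (unit4 l k)"
      using that by (intro mat4_eqI) auto
    then show ?thesis using that br[of "unit4 k l" "unit4 l k"] U[of l k] by simp
  qed
  have "f \<in> I" if f: "f \<in> sl4" for f
  proof (rule mem_subspace_from_entries[OF sl4_mat4[OF f] sub])
    show "diagonal_part f \<in> I"
      using diagonal_part_diagonal4[OF f] sub
      by (rule diagonal4_mem_subspace) (simp add: D)
  qed (rule U)
  then show ?thesis using \<open>I \<subseteq> sl4\<close> by blast
qed


lemma scale_mem_iff:
  assumes "seq.subspace W" "c \<noteq> 0" "seq_scale c x \<in> W"
  shows "x \<in> W"
  using seq.subspace_scale[OF assms(1,3), of "inverse c"] assms(2) by simp

text \<open>If x_ij \<noteq> 0 with i \<noteq> j, then E_ji squares to 0 and bracketing x twice with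
  it leaves -2 x_ij E_ji. Otherwise x is diagonal; being traceless and nonzero it is not scalar, so
  its bracket with some E_0i is a nonzero multiple of E_0i.\<close>

lemma sl4_ideal_nonzero:
  assumes I: "sl4.lie_ideal I" and x: "x \<in> I" "x \<noteq> 0"
  shows "\<exists>i<4. \<exists>j<4. i \<noteq> j \<and> unit4 i j \<in> I"
proof -
  have sub: "seq.subspace I" and xs: "x \<in> sl4"
    and br: "\<And>z y. z \<in> sl4 \<Longrightarrow> y \<in> I \<Longrightarrow> sl4_bracket z y \<in> I"
    using I x by (auto simp: sl4.lie_ideal_def)
  show ?thesis
  proof (cases "\<exists>i<4. \<exists>j<4. i \<noteq> j \<and> entry x i j \<noteq> 0")
    case True
    then obtain i j where ij: "i < 4" "j < 4" "i \<noteq> j" "entry x i j \<noteq> 0"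
      by blast
    have "seq_scale (- 2 * entry x i j) (unit4 j i) = sl4_bracket (unit4 j i) (sl4_bracket (unit4 j i) x)"
      using ij by (intro mat4_eqI) auto
    also have "\<dots> \<in> I"
      using br x(1) ij by simp
    finally show ?thesis
      using scale_mem_iff[OF sub, of "- 2 * entry x i j" "unit4 j i"] ij by auto
  next
    case False
    have "\<exists>i<4. i \<noteq> 0 \<and> entry x i i \<noteq> entry x 0 0"
    proof (rule ccontr)
      assume "\<not> ?thesis"
      then obtain c where c: "entry x i i = c" if "i < 4" for i
        by metis
      then have "4 * c = 0"
        using xs by (simp add: sl4_def)
      then have "entry x i j = 0" if "i < 4" "j < 4" for i j
        using that False c by (cases "i = j") auto
      then have "x = 0"
        using xs by (intro mat4_eqI) (auto simp: sl4_mat4)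
      then show False using x by simp
    qed
    then obtain i where i: "i < 4" "i \<noteq> 0" "entry x i i \<noteq> entry x 0 0"
      by blast
    have "entry x a b = 0" if "a < 4" "b < 4" "a \<noteq> b" for a b
      using False that by blast
    then have "seq_scale (entry x i i - entry x 0 0) (unit4 0 i) = sl4_bracket (unit4 0 i) x"
      using i by (intro mat4_eqI) auto
    also have "\<dots> \<in> I"
      using br x(1) i by simp
    finally show ?thesis
      using scale_mem_iff[OF sub, of "entry x i i - entry x 0 0" "unit4 0 i"] i
      by (intro exI[of _ 0] conjI exI[of _ i]) auto
  qed
qed

lemma simple_sl4: "sl4.simple_lie"
  unfolding sl4.simple_lie_def
proof (intro conjI allI impI)
  have "entry (sl4_bracket (unit4 0 1) (unit4 1 0)) 0 0 = 1"
    by simp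
  then have "sl4_bracket (unit4 0 1) (unit4 1 0) \<noteq> 0"
    by (metis entry_linear(1) zero_neq_one)
  then show "\<exists>x\<in>sl4. \<exists>y\<in>sl4. sl4_bracket x y \<noteq> 0"
    by (metis unit4_sl4 zero_neq_one)
next
  fix I assume I: "sl4.lie_ideal I"
  then have "0 \<in> I"
    by (auto simp: sl4.lie_ideal_def seq.subspace_0)
  then show "I = {0} \<or> I = sl4"
    using sl4_ideal_nonzero[OF I] sl4_ideal_unit[OF I] by blast
qed

section \<open>The Cartan subalgebra of diagonal matrices\<close>

lemma entry_bracket_diagonal4:
  assumes h: "h \<in> diagonal4" and ij: "i < 4" "j < 4"
  shows "entry (sl4_bracket h x) i j = (entry h i i - entry h j j) * entry x i j"
    and "entry (sl4_bracket x h) i j = (entry h j j - entry h i i) * entry x i j"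
proof -
  have "(\<Sum>k<4. entry h i k * entry x k j) = (\<Sum>k<4. if k = i then entry h i i * entry x i j else 0)"
    "(\<Sum>k<4. entry x i k * entry h k j) = (\<Sum>k<4. if k = j then entry x i j * entry h j j else 0)"
    by (rule sum.cong; use h ij in \<open>auto simp: diagonal4_def\<close>)+
  then have sums: "(\<Sum>k<4. entry h i k * entry x k j) = entry h i i * entry x i j"
    "(\<Sum>k<4. entry x i k * entry h k j) = entry x i j * entry h j j"
    using ij by simp_all
  then show "entry (sl4_bracket h x) i j = (entry h i i - entry h j j) * entry x i j"
    "entry (sl4_bracket x h) i j = (entry h j j - entry h i i) * entry x i j"
    using ij by (simp_all add: entry_bracket sum_subtractf algebra_simps)
qed

lemma bracket_diagonal4: "h \<in> diagonal4 \<Longrightarrow> x \<in> diagonal4 \<Longrightarrow> sl4_bracket h x = 0"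
  by (rule mat4_eqI) (auto simp: entry_bracket_diagonal4 diagonal4_def[THEN eqset_imp_iff, of x] )

lemma cartan_subalgebra_diagonal4: "sl4.cartan_subalgebra diagonal4"
  unfolding sl4.cartan_subalgebra_def
proof (intro conjI)
  have 0: "0 \<in> diagonal4"
    using subspace_diagonal4 by (rule seq.subspace_0)
  show "sl4.lie_subalgebra diagonal4"
    using 0 by (auto simp: sl4.lie_subalgebra_def subspace_diagonal4 bracket_diagonal4 diagonal4_sl4)
  have "{sl4_bracket x y |x y. x \<in> diagonal4 \<and> y \<in> diagonal4} = {0}"
    using 0 by (auto simp: bracket_diagonal4 intro!: exI[of _ 0])
  then have "sl4.lower_central diagonal4 (Suc 0) = {0}"
    by (simp add: seq.span_insert_0)
  then show "sl4.nilpotent_lie diagonal4"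
    unfolding sl4.nilpotent_lie_def by blast
  show "{x \<in> sl4. \<forall>y\<in>diagonal4. sl4_bracket x y \<in> diagonal4} = diagonal4"
  proof (intro equalityI subsetI)
    fix x assume "x \<in> {x \<in> sl4. \<forall>y\<in>diagonal4. sl4_bracket x y \<in> diagonal4}"
    then have x: "x \<in> sl4" "\<And>y. y \<in> diagonal4 \<Longrightarrow> sl4_bracket x y \<in> diagonal4"
      by auto
    have "entry x i j = 0" if ij: "i < 4" "j < 4" "i \<noteq> j" for i j
    proof -
      \<comment> \<open>This bracket multiplies the entry (i, j) by -2, so a diagonal result forces
        that entry to vanish.\<close>
      have "sl4_bracket x (unit4 i i - unit4 j j) \<in> diagonal4"
        using ij by (intro x(2)) simp
      then have "entry (sl4_bracket x (unit4 i i - unit4 j j)) i j = 0"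
        using ij unfolding diagonal4_def by blast
      then show ?thesis
        using ij by (simp add: entry_bracket_diagonal4)
    qed
    then show "x \<in> diagonal4" using x(1) by (simp add: diagonal4_def)
  qed (use 0 in \<open>auto simp: bracket_diagonal4 diagonal4_sl4\<close>)
qed

section \<open>Roots and root spaces\<close>

definition diag4 :: "(nat \<Rightarrow> complex) \<Rightarrow> nat \<Rightarrow> complex" where
  "diag4 c = of_entries (\<lambda>i j. if i = j then c i else 0)"

lemma entry_diag4 [simp]: "i < 4 \<Longrightarrow> j < 4 \<Longrightarrow> entry (diag4 c) i j = (if i = j then c i else 0)"
  by (simp add: diag4_def)

lemma diag4_diagonal4: "(\<Sum>i<4. c i) = 0 \<Longrightarrow> diag4 c \<in> diagonal4"
  by (simp add: diagonal4_def sl4_def) (simp add: diag4_def)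

definition root4 :: "nat \<Rightarrow> nat \<Rightarrow> (nat \<Rightarrow> complex) \<Rightarrow> complex" where
  "root4 i j h = (if h \<in> diagonal4 then entry h i i - entry h j j else 0)"

text \<open>A root is singled out by its value on its own coroot, so one diagonal matrix suffices to
  cut out the root space.\<close>

lemma root4_coroot:
  assumes "i < 4" "j < 4" "k < 4" "l < 4" "i \<noteq> j"
  shows "root4 k l (unit4 i i - unit4 j j) = 2 \<longleftrightarrow> k = i \<and> l = j"
  using assms by (auto simp: root4_def)

lemma root4_dual_space: "i < 4 \<Longrightarrow> j < 4 \<Longrightarrow> root4 i j \<in> sl4.dual_space diagonal4"
  using subspace_diagonal4
  by (auto simp: sl4.dual_space_def root4_def seq.subspace_def algebra_simps)

lemma weight_space_root4:
  assumes "i < 4" "j < 4" "i \<noteq> j"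
  shows "sl4.weight_space diagonal4 (root4 i j) =
    {x \<in> sl4. \<forall>k<4. \<forall>l<4. entry x k l \<noteq> 0 \<longrightarrow> k = i \<and> l = j}"
proof (intro equalityI subsetI)
  let ?h = "unit4 i i - unit4 j j"
  fix x assume "x \<in> sl4.weight_space diagonal4 (root4 i j)"
  then have x: "x \<in> sl4" "sl4_bracket ?h x = seq_scale (root4 i j ?h) x"
    using assms by (auto simp: sl4.weight_space_def)
  have "k = i \<and> l = j" if "k < 4" "l < 4" "entry x k l \<noteq> 0" for k l
  proof -
    have "entry (sl4_bracket ?h x) k l = root4 k l ?h * entry x k l"
      using that assms by (simp only: entry_bracket_diagonal4 root4_def diff_unit4_diagonal4 if_True)
    then have "root4 k l ?h = root4 i j ?h"
      using that by (simp add: x(2))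
    then show ?thesis
      using root4_coroot[of i j i j] root4_coroot[of i j k l] assms that by simp
  qed
  then show "x \<in> {x \<in> sl4. \<forall>k<4. \<forall>l<4. entry x k l \<noteq> 0 \<longrightarrow> k = i \<and> l = j}"
    using x(1) by blast
next
  fix x assume x: "x \<in> {x \<in> sl4. \<forall>k<4. \<forall>l<4. entry x k l \<noteq> 0 \<longrightarrow> k = i \<and> l = j}"
  have "sl4_bracket h x = seq_scale (root4 i j h) x" if "h \<in> diagonal4" for h
    using that x by (intro mat4_eqI) (auto simp: entry_bracket_diagonal4 root4_def sl4_mat4)
  then show "x \<in> sl4.weight_space diagonal4 (root4 i j)"
    using x by (simp add: sl4.weight_space_def)
qed

lemma unit4_weight_space: "i < 4 \<Longrightarrow> j < 4 \<Longrightarrow> i \<noteq> j \<Longrightarrow>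
  unit4 i j \<in> sl4.weight_space diagonal4 (root4 i j)"
  by (auto simp: weight_space_root4 split: if_splits)

lemma root_system_sl4:
  "sl4.root_system diagonal4 = {root4 i j |i j. i < 4 \<and> j < 4 \<and> i \<noteq> j}"
proof (intro equalityI subsetI)
  fix \<beta> assume "\<beta> \<in> sl4.root_system diagonal4"
  then have \<beta>: "\<beta> \<in> sl4.dual_space diagonal4" "\<beta> \<noteq> (\<lambda>_. 0)"
    "sl4.weight_space diagonal4 \<beta> \<noteq> {0}" by (auto simp: sl4.root_system_def)
  moreover have "0 \<in> sl4.weight_space diagonal4 \<beta>"
    using subspace_sl4
    by (auto simp: sl4.weight_space_def seq.subspace_0 intro!: mat4_eqI) (simp add: entry_bracket)
  ultimately obtain x where x: "x \<in> sl4.weight_space diagonal4 \<beta>" "x \<noteq> 0"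
    by blast
  then have "x \<in> sl4" by (simp add: sl4.weight_space_def)
  \<comment> \<open>Any nonzero entry of a weight vector decides the weight, since a diagonal h
    scales the entry (i, j) by h_ii - h_jj. A diagonal entry would make the weight zero.\<close>
  then obtain i j where ij: "i < 4" "j < 4" "entry x i j \<noteq> 0"
    using x(2) mat4_eqI[of x 0] by (auto simp: sl4_mat4)
  have "\<beta> h = root4 i j h" for h
  proof (cases "h \<in> diagonal4")
    case True
    then have "sl4_bracket h x = seq_scale (\<beta> h) x"
      using x(1) by (simp add: sl4.weight_space_def)
    then have "entry (sl4_bracket h x) i j = entry (seq_scale (\<beta> h) x) i j"
      by simp
    then show ?thesis
      using True ij by (simp add: entry_bracket_diagonal4 root4_def)
  qed (use \<beta>(1) in \<open>simp add: root4_def sl4.dual_space_def\<close>)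
  then have "\<beta> = root4 i j" by blast
  moreover have "i \<noteq> j"
  proof
    assume "i = j"
    then have "\<beta> = (\<lambda>_. 0)"
      unfolding \<open>\<beta> = root4 i j\<close> by (simp add: root4_def fun_eq_iff)
    then show False using \<beta>(2) by simp
  qed
  ultimately show "\<beta> \<in> {root4 i j |i j. i < 4 \<and> j < 4 \<and> i \<noteq> j}"
    using ij by blast
next
  fix \<beta> assume "\<beta> \<in> {root4 i j |i j. i < 4 \<and> j < 4 \<and> i \<noteq> j}"
  then obtain i j where \<beta>: "\<beta> = root4 i j" "i < 4" "j < 4" "i \<noteq> j"
    by blast
  have "root4 i j (unit4 i i - unit4 j j) = 2"
    using root4_coroot \<beta> by simp
  then have "root4 i j \<noteq> (\<lambda>_. 0)"
    by auto
  moreover have "entry (unit4 i j) i j \<noteq> entry 0 i j"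
    using \<beta> by simp
  then have "sl4.weight_space diagonal4 (root4 i j) \<noteq> {0}"
    using unit4_weight_space[of i j] \<beta> by (metis singletonD)
  ultimately show "\<beta> \<in> sl4.root_system diagonal4"
    using \<beta> root4_dual_space by (simp add: sl4.root_system_def)
qed


section \<open>The trace form\<close>

definition trace_form :: "(nat \<Rightarrow> complex) \<Rightarrow> (nat \<Rightarrow> complex) \<Rightarrow> complex" where
  "trace_form f g = (\<Sum>i<4. \<Sum>j<4. entry f i j * entry g j i)"

lemma trace_form_eq: "trace_form f g = (\<Sum>i<4. entry (mult4 f g) i i)"
  by (simp add: trace_form_def mult4_def)

lemma trace_form_commute: "trace_form f g = trace_form g f"
  unfolding trace_form_def by (subst sum.swap) (simp add: mult.commute)

lemma trace_form_linear:
  "trace_form (f + g) h = trace_form f h + trace_form g h"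
  "trace_form (f - g) h = trace_form f h - trace_form g h"
  "trace_form (seq_scale c f) h = c * trace_form f h"
  "trace_form h (f - g) = trace_form h f - trace_form h g"
  by (simp_all add: trace_form_def algebra_simps sum.distrib sum_subtractf sum_distrib_left)

lemma trace_form_mult4: "trace_form (mult4 f g) h = trace_form f (mult4 g h)"
  by (simp add: trace_form_eq mult4_assoc)

lemma trace_form_bracket: "trace_form (sl4_bracket x y) z = trace_form x (sl4_bracket y z)"
proof -
  have "trace_form (mult4 y x) z = trace_form x (mult4 z y)"
    by (metis trace_form_commute trace_form_mult4)
  then show ?thesis
    by (simp add: bracket_mult4 trace_form_linear trace_form_mult4)
qed

lemma trace_form_unit4: "i < 4 \<Longrightarrow> j < 4 \<Longrightarrow> trace_form f (unit4 j i) = entry f i j"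
proof -
  assume ij: "i < 4" "j < 4"
  have "trace_form f (unit4 j i) = (\<Sum>k<4. \<Sum>l<4. if l = j then if k = i then entry f i j else 0 else 0)"
    unfolding trace_form_def by (intro sum.cong) auto
  then show ?thesis using ij by simp
qed

lemma diagonal4_eq_0:
  assumes "f \<in> diagonal4" "\<And>i. i < 3 \<Longrightarrow> entry f i i = entry f (Suc i) (Suc i)"
  shows "f = 0"
proof -
  have eq: "entry f i i = entry f 0 0" if "i < 4" for i
    using that
  proof (induction i)
    case (Suc i)
    then show ?case using assms(2)[of i] by simp
  qed simp
  obtain c where c: "entry f i i = c" if "i < 4" for i
    using eq by blast
  then have "4 * c = 0"
    using assms(1) by (simp add: diagonal4_def sl4_def)
  then have "entry f i j = entry 0 i j" if "i < 4" "j < 4" for i j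
    using that c assms(1) by (cases "i = j") (auto simp: diagonal4_def)
  then show ?thesis
    using assms(1) by (intro mat4_eqI) (auto simp: diagonal4_def sl4_def)
qed

lemma trace_form_nondegenerate:
  assumes x: "x \<in> sl4" "\<And>y. y \<in> sl4 \<Longrightarrow> trace_form x y = 0"
  shows "x = 0"
proof (rule diagonal4_eq_0)
  have "entry x i j = 0" if "i < 4" "j < 4" "i \<noteq> j" for i j
    using x(2)[of "unit4 j i"] that by (simp add: trace_form_unit4)
  then show "x \<in> diagonal4"
    using x(1) by (simp add: diagonal4_def)
next
  fix i :: nat assume "i < 3"
  then show "entry x i i = entry x (Suc i) (Suc i)"
    using x(2)[of "unit4 i i - unit4 (Suc i) (Suc i)"] diagonal4_sl4[OF diff_unit4_diagonal4, of i "Suc i"]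
    by (simp add: trace_form_linear trace_form_unit4)
qed

lemma invariant_trace_form: "sl4.invariant_form trace_form"
  unfolding sl4.invariant_form_def
  by (intro conjI ballI allI impI trace_form_commute trace_form_linear trace_form_bracket)
    (rule trace_form_nondegenerate, auto)

section \<open>Weights in coordinates and the form on the dual\<close>

definition weight4 :: "(nat \<Rightarrow> complex) \<Rightarrow> (nat \<Rightarrow> complex) \<Rightarrow> complex" where
  "weight4 c h = (if h \<in> diagonal4 then \<Sum>i<4. c i * entry h i i else 0)"

lemma weight4_dual_space: "weight4 c \<in> sl4.dual_space diagonal4"
  using subspace_diagonal4
  by (auto simp: sl4.dual_space_def weight4_def seq.subspace_def algebra_simps sum.distrib sum_distrib_left)

lemma root4_weight4:
  assumes "i < 4" "j < 4"
  shows "root4 i j = weight4 (\<lambda>k. (if k = i then 1 else 0) - (if k = j then 1 else 0))"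
proof
  fix h
  have "(\<Sum>k<4. ((if k = i then 1 else 0) - (if k = j then 1 else 0)) * entry h k k)
     = (\<Sum>k<4. if k = i then entry h i i else 0) - (\<Sum>k<4. if k = j then entry h j j else 0)"
    unfolding sum_subtractf[symmetric] by (intro sum.cong) auto
  then show "root4 i j h = weight4 (\<lambda>k. (if k = i then 1 else 0) - (if k = j then 1 else 0)) h"
    using assms by (simp add: root4_def weight4_def)
qed

lemma dual_space_weight4:
  assumes "\<mu> \<in> sl4.dual_space diagonal4"
  obtains c where "\<mu> = weight4 c"
proof -
  define D where "D i = unit4 i i - unit4 (Suc i) (Suc i)" for i
  \<comment> \<open>The differences of consecutive coordinates must be the values on the simple
    coroots D; normalizing the last coordinate to 0 determines the others as tail sums.\<close>
  define c where "c = (\<lambda>_ :: nat. 0 :: complex)(0 := \<mu> (D 0) + \<mu> (D 1) + \<mu> (D 2),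
    1 := \<mu> (D 1) + \<mu> (D 2), 2 := \<mu> (D 2))"
  have \<mu>: "\<mu> (x + y) = \<mu> x + \<mu> y" "\<mu> (seq_scale a x) = a * \<mu> x" if "x \<in> diagonal4" "y \<in> diagonal4" for x y a
    using assms that by (auto simp: sl4.dual_space_def)
  have \<mu>c: "weight4 c (x + y) = weight4 c x + weight4 c y" "weight4 c (seq_scale a x) = a * weight4 c x"
    if "x \<in> diagonal4" "y \<in> diagonal4" for x y a
    using weight4_dual_space[of c] that by (auto simp: sl4.dual_space_def)
  have "h \<in> {h \<in> diagonal4. \<mu> h = weight4 c h}" if "h \<in> diagonal4" for h
    using that
  proof (rule diagonal4_mem_subspace)
    have 0: "0 \<in> diagonal4"
      using subspace_diagonal4 by (rule seq.subspace_0)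
    then have "\<mu> 0 = 0" "weight4 c 0 = 0"
      using \<mu>(2)[of 0 0 0] \<mu>c(2)[of 0 0 0] by simp_all
    then show "seq.subspace {h \<in> diagonal4. \<mu> h = weight4 c h}"
      using subspace_diagonal4 \<mu> \<mu>c 0 by (simp add: seq.subspace_def)
  next
    fix i :: nat assume "i < 3"
    then have "i = 0 \<or> i = 1 \<or> i = 2" by auto
    then have "\<mu> (D i) = weight4 c (D i)"
      by (elim disjE) (simp_all add: D_def weight4_def sum_less_4 c_def)
    then show "unit4 i i - unit4 (Suc i) (Suc i) \<in> {h \<in> diagonal4. \<mu> h = weight4 c h}"
      using \<open>i < 3\<close> by (simp add: D_def)
  qed
  then have "\<mu> h = weight4 c h" for h
    using assms by (cases "h \<in> diagonal4") (auto simp: sl4.dual_space_def weight4_def)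
  then show ?thesis using that by blast
qed

lemma trace_form_diagonal4:
  assumes "h \<in> diagonal4"
  shows "trace_form (diag4 c) h = (\<Sum>i<4. c i * entry h i i)"
proof -
  have "trace_form (diag4 c) h = (\<Sum>i<4. \<Sum>j<4. if j = i then c i * entry h i i else 0)"
    unfolding trace_form_def by (intro sum.cong) auto
  then show ?thesis by simp
qed

lemma dual_vector_weight4:
  assumes "(\<Sum>i<4. c i) = 0"
  shows "sl4.dual_vector trace_form diagonal4 (weight4 c) = diag4 c"
  unfolding sl4.dual_vector_def
proof (rule the_equality)
  show "diag4 c \<in> diagonal4 \<and> (\<forall>h\<in>diagonal4. trace_form (diag4 c) h = weight4 c h)"
    using assms by (simp add: diag4_diagonal4 trace_form_diagonal4 weight4_def)
  fix t assume t: "t \<in> diagonal4 \<and> (\<forall>h\<in>diagonal4. trace_form t h = weight4 c h)"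
  then have "trace_form (t - diag4 c) h = 0" if "h \<in> diagonal4" for h
    using that by (simp add: trace_form_linear trace_form_diagonal4 weight4_def)
  then have D: "trace_form (t - diag4 c) (unit4 i i - unit4 (Suc i) (Suc i)) = 0" if "i < 3" for i
    using that by simp
  have "t - diag4 c = 0"
  proof (rule diagonal4_eq_0)
    show "t - diag4 c \<in> diagonal4"
      using t assms diag4_diagonal4 seq.subspace_diff[OF subspace_diagonal4] by simp
    fix i :: nat assume "i < 3"
    then show "entry (t - diag4 c) i i = entry (t - diag4 c) (Suc i) (Suc i)"
      using D[OF \<open>i < 3\<close>] by (simp add: trace_form_linear(4) trace_form_unit4)
  qed
  then show "t = diag4 c" by simp
qed

text \<open>On traceless matrices a constant coordinate vector is the zero functional, so
  coordinates can be normalized to have sum 0.\<close>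

lemma weight4_shift: "weight4 (\<lambda>i. c i - a) = weight4 c"
proof
  fix h
  show "weight4 (\<lambda>i. c i - a) h = weight4 c h"
  proof (cases "h \<in> diagonal4")
    case True
    then have "(\<Sum>i<4. a * entry h i i) = 0"
      by (simp add: diagonal4_def sl4_def flip: sum_distrib_left)
    then show ?thesis
      by (simp add: weight4_def left_diff_distrib sum_subtractf)
  qed (simp add: weight4_def)
qed

lemma dual_form_weight4:
  assumes c': "(\<Sum>i<4. c' i) = 0"
  shows "sl4.dual_form trace_form diagonal4 (weight4 c) (weight4 c') = (\<Sum>i<4. c i * c' i)"
proof -
  \<comment> \<open>Subtracting the mean makes the representing diagonal matrix traceless; the
    correction it causes in the form is killed by the zero sum of c'.\<close>
  define a where "a = (\<Sum>i<4. c i) / 4"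
  have "(\<Sum>i<4. c i - a) = 0"
    by (simp add: a_def sum_subtractf)
  then have *: "sl4.dual_vector trace_form diagonal4 (weight4 c) = diag4 (\<lambda>i. c i - a)"
    by (subst weight4_shift[symmetric, of c a]) (rule dual_vector_weight4)
  have "sl4.dual_form trace_form diagonal4 (weight4 c) (weight4 c') = (\<Sum>i<4. (c i - a) * c' i)"
    by (simp add: sl4.dual_form_def * dual_vector_weight4 c' trace_form_diagonal4 diag4_diagonal4)
  also have "\<dots> = (\<Sum>i<4. c i * c' i) - a * (\<Sum>i<4. c' i)"
    by (simp add: left_diff_distrib sum_subtractf sum_distrib_left)
  finally show ?thesis using c' by simp
qed

lemma dual_form_root4:
  assumes "i < 4" "j < 4"
  shows "sl4.dual_form trace_form diagonal4 (weight4 c) (root4 i j) = c i - c j"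
proof -
  have "(\<Sum>k<4. (if k = i then 1 else 0) - (if k = j then 1 else 0) :: complex) = 0"
    using assms by (simp add: sum_subtractf)
  moreover have "(\<Sum>k<4. c k * ((if k = i then 1 else 0) - (if k = j then 1 else 0))) =
      (\<Sum>k<4. if k = i then c i else 0) - (\<Sum>k<4. if k = j then c j else 0)"
    unfolding sum_subtractf[symmetric] by (intro sum.cong) auto
  ultimately show ?thesis
    using assms by (simp add: root4_weight4 dual_form_weight4)
qed

text \<open>This is the normalization that \<open>simple_lie_with_base\<close> asks for, and the
  reason for the trace form instead of the Killing form, which is eight times as large.\<close>

lemma dual_form_root4_self:
  "i < 4 \<Longrightarrow> j < 4 \<Longrightarrow> i \<noteq> j \<Longrightarrow> sl4.dual_form trace_form diagonal4 (root4 i j) (root4 i j) = 2"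
  by (subst (1) root4_weight4) (simp_all add: dual_form_root4)

section \<open>Simple roots and the normalized base\<close>

definition simple_root4 :: "nat \<Rightarrow> (nat \<Rightarrow> complex) \<Rightarrow> complex" where
  "simple_root4 i = root4 i (Suc i)"

lemma simple_root4_numeral:
  "simple_root4 0 = root4 0 1" "simple_root4 1 = root4 1 2" "simple_root4 2 = root4 2 3"
  by (simp_all add: simple_root4_def eval_nat_numeral)

lemma less_3_cases: "i < 3 \<longleftrightarrow> i = 0 \<or> i = 1 \<or> i = (2::nat)"
  by auto

lemma sum_less_3: "(\<Sum>k<3. f k) = f 0 + f 1 + f (2::nat)"
  by (simp add: numeral_eq_Suc)

lemma root4_sum_simple:
  assumes "i < j" "j < 4"
  shows "root4 i j = (\<lambda>h. \<Sum>k<3. of_nat (if i \<le> k \<and> k < j then 1 else 0) * simple_root4 k h)"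
proof
  fix h
  have "j = 1 \<or> j = 2 \<or> j = 3" "i = 0 \<or> i = 1 \<or> i = 2" using assms by auto
  then show "root4 i j h = (\<Sum>k<3. of_nat (if i \<le> k \<and> k < j then 1 else 0) * simple_root4 k h)"
    using assms(1) by (elim disjE) (simp_all add: sum_less_3 simple_root4_numeral root4_def del: One_nat_def)
qed

lemma root4_flip: "root4 j i = (\<lambda>h. - root4 i j h)"
  by (auto simp: root4_def)

interpretation sl4: simple_lie_with_base seq_scale sl4 sl4_bracket diagonal4 trace_form 3 simple_root4
proof
  show "sl4.simple_lie" by (rule simple_sl4)
  show "sl4.cartan_subalgebra diagonal4" by (rule cartan_subalgebra_diagonal4)
  show "sl4.invariant_form trace_form" by (rule invariant_trace_form)
next
  fix i :: nat assume "i < 3"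
  then have "i < 4" "Suc i < 4" "i \<noteq> Suc i" by simp_all
  then show "simple_root4 i \<in> sl4.root_system diagonal4"
    unfolding simple_root4_def root_system_sl4 by blast
next
  fix c assume "(\<lambda>h. \<Sum>i<3. c i * simple_root4 i h) = (\<lambda>_. 0)"
  then have 0: "(\<Sum>i<3. c i * simple_root4 i h) = 0" for h
    by (rule fun_cong)
  \<comment> \<open>The three diagonal matrices used next are multiples of the fundamental
    coweights: each is annihilated by all simple roots but one, and so isolates one
    coefficient.\<close>
  define h where "h = (\<lambda>xs. diag4 (\<lambda>i. xs ! i))"
  have "h [3, -1, -1, -1] \<in> diagonal4" "h [1, 1, -1, -1] \<in> diagonal4" "h [1, 1, 1, -3] \<in> diagonal4"
    unfolding h_def by (intro diag4_diagonal4; simp add: sum_less_4)+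
  then have "c 0 = 0" "c 1 = 0" "c 2 = 0"
    using 0[of "h [3, -1, -1, -1]"] 0[of "h [1, 1, -1, -1]"] 0[of "h [1, 1, 1, -3]"]
    by (simp_all add: sum_less_3 simple_root4_numeral root4_def del: One_nat_def) (simp_all add: h_def)
  then show "\<forall>i<3. c i = 0" using less_3_cases by auto
next
  fix \<beta> assume "\<beta> \<in> sl4.root_system diagonal4"
  then obtain i j where \<beta>: "\<beta> = root4 i j" "i < 4" "j < 4" "i \<noteq> j"
    unfolding root_system_sl4 by blast
  show "Re (sl4.dual_form trace_form diagonal4 \<beta> \<beta>) \<ge> 2"
    using \<beta> by (simp add: dual_form_root4_self)
  show "\<exists>n :: nat \<Rightarrow> nat. \<beta> = (\<lambda>h. \<Sum>i<3. of_nat (n i) * simple_root4 i h) \<or>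
      \<beta> = (\<lambda>h. - (\<Sum>i<3. of_nat (n i) * simple_root4 i h))"
  proof (cases "i < j")
    case True
    then have "\<beta> = (\<lambda>h. \<Sum>k<3. of_nat (if i \<le> k \<and> k < j then 1 else 0) * simple_root4 k h)"
      using root4_sum_simple \<beta> by simp
    then show ?thesis
      by (intro exI[of _ "\<lambda>k. if i \<le> k \<and> k < j then 1 else 0"] disjI1)
  next
    case False
    then have "root4 j i = (\<lambda>h. \<Sum>k<3. of_nat (if j \<le> k \<and> k < i then 1 else 0) * simple_root4 k h)"
      using root4_sum_simple \<beta> by simp
    then have "\<beta> = (\<lambda>h. - (\<Sum>k<3. of_nat (if j \<le> k \<and> k < i then 1 else 0) * simple_root4 k h))"
      unfolding \<beta>(1) root4_flip[of i j] by (rule arg_cong)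
    then show ?thesis
      by (intro exI[of _ "\<lambda>k. if j \<le> k \<and> k < i then 1 else 0"] disjI2)
  qed
next
  have "root4 0 1 \<in> sl4.root_system diagonal4"
    unfolding root_system_sl4 by (intro CollectI exI[of _ 0] exI[of _ 1]) simp
  then show "\<exists>\<beta>\<in>sl4.root_system diagonal4. sl4.dual_form trace_form diagonal4 \<beta> \<beta> = 2"
    using dual_form_root4_self[of 0 1] by auto
qed


section \<open>Positive, Levi and radical roots\<close>

lemma root4_positive_iff:
  assumes "i < 4" "j < 4" "i \<noteq> j"
  shows "root4 i j \<in> sl4.positive_roots \<longleftrightarrow> i < j"
proof
  assume "root4 i j \<in> sl4.positive_roots"
  then obtain n :: "nat \<Rightarrow> nat" where n: "root4 i j = (\<lambda>h. \<Sum>k<3. of_nat (n k) * simple_root4 k h)"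
    unfolding sl4.positive_roots_def by blast
  \<comment> \<open>The matrix diag(3, 1, -1, -3) is the sum of the positive coroots; every simple
    root takes the value 2 on it, so it measures twice the height.\<close>
  define h where "h = diag4 (\<lambda>i. 3 - 2 * of_nat i)"
  have h: "h \<in> diagonal4"
    unfolding h_def by (rule diag4_diagonal4) (simp add: sum_less_4)
  then have root: "root4 a b h = 2 * of_nat b - 2 * of_nat a" if "a < 4" "b < 4" for a b
    using that by (simp add: root4_def) (simp add: h_def)
  then have "simple_root4 k h = 2" if "k < 3" for k
    using that by (simp add: simple_root4_def)
  then have "(\<Sum>k<3. of_nat (n k) * simple_root4 k h) = 2 * of_nat (\<Sum>k<3. n k)"
    by (simp add: sum_distrib_left mult.commute)
  then have "2 * of_nat j - 2 * of_nat i = (2 * of_nat (\<Sum>k<3. n k) :: complex)"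
    using fun_cong[OF n, of h] root assms by simp
  then have "of_nat (2 * j) = (of_nat (2 * i + 2 * (\<Sum>k<3. n k)) :: complex)"
    by (simp add: algebra_simps)
  then have "2 * j = 2 * i + 2 * (\<Sum>k<3. n k)"
    by (simp only: of_nat_eq_iff)
  then show "i < j" using assms(3) by linarith
next
  assume "i < j"
  then show "root4 i j \<in> sl4.positive_roots"
    using root4_sum_simple[of i j] assms
    unfolding sl4.positive_roots_def root_system_sl4
    by (intro CollectI conjI exI[of _ i] exI[of _ j] exI[of _ "\<lambda>k. if i \<le> k \<and> k < j then 1 else 0"]) auto
qed

lemma root4_levi_iff:
  assumes "i < 4" "j < 4" "i \<noteq> j"
  shows "root4 i j \<in> sl4.levi_roots {0, 2} \<longleftrightarrow> (i < 2 \<longleftrightarrow> j < 2)"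
proof
  assume "root4 i j \<in> sl4.levi_roots {0, 2}"
  then obtain c :: "nat \<Rightarrow> complex" where c: "root4 i j = (\<lambda>h. \<Sum>k\<in>{0, 2}. c k * simple_root4 k h)"
    unfolding sl4.levi_roots_def by blast
  \<comment> \<open>The matrix diag(1, 1, -1, -1) is central in the Levi factor: \<alpha>_0 and
    \<alpha>_2 vanish on it, and the roots that cross the blocks do not.\<close>
  define h where "h = diag4 (\<lambda>i. if i < 2 then 1 else - 1)"
  have h: "h \<in> diagonal4"
    unfolding h_def by (rule diag4_diagonal4) (simp add: sum_less_4)
  then have root: "root4 a b h = (if a < 2 then 1 else - 1) - (if b < 2 then 1 else - 1)"
    if "a < 4" "b < 4" for a b
    using that by (simp add: root4_def) (simp add: h_def)
  then have "root4 i j h = 0"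
    using fun_cong[OF c, of h] by (simp add: simple_root4_def)
  then show "i < 2 \<longleftrightarrow> j < 2"
    using root[OF assms(1,2)] by (auto split: if_splits)
next
  assume "i < 2 \<longleftrightarrow> j < 2"
  then have "(i = 0 \<and> j = 1) \<or> (i = 1 \<and> j = 0) \<or> (i = 2 \<and> j = 3) \<or> (i = 3 \<and> j = 2)"
    using assms by auto
  moreover have "\<exists>c :: nat \<Rightarrow> complex. root4 0 1 = (\<lambda>h. \<Sum>k\<in>{0, 2}. c k * simple_root4 k h)"
    by (rule exI[of _ "\<lambda>k. if k = 0 then 1 else 0"]) (simp add: simple_root4_numeral)
  moreover have "\<exists>c :: nat \<Rightarrow> complex. root4 1 0 = (\<lambda>h. \<Sum>k\<in>{0, 2}. c k * simple_root4 k h)"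
    by (rule exI[of _ "\<lambda>k. if k = 0 then - 1 else 0"]) (auto simp: simple_root4_numeral root4_def)
  moreover have "\<exists>c :: nat \<Rightarrow> complex. root4 2 3 = (\<lambda>h. \<Sum>k\<in>{0, 2}. c k * simple_root4 k h)"
    by (rule exI[of _ "\<lambda>k. if k = 2 then 1 else 0"]) (simp add: simple_root4_numeral)
  moreover have "\<exists>c :: nat \<Rightarrow> complex. root4 3 2 = (\<lambda>h. \<Sum>k\<in>{0, 2}. c k * simple_root4 k h)"
    by (rule exI[of _ "\<lambda>k. if k = 2 then - 1 else 0"]) (auto simp: simple_root4_numeral root4_def)
  ultimately have "\<exists>c :: nat \<Rightarrow> complex. root4 i j = (\<lambda>h. \<Sum>k\<in>{0, 2}. c k * simple_root4 k h)"
    by blast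
  moreover have "root4 i j \<in> sl4.root_system diagonal4"
    unfolding root_system_sl4 using assms by blast
  ultimately show "root4 i j \<in> sl4.levi_roots {0, 2}"
    unfolding sl4.levi_roots_def by blast
qed

lemma root4_radical_iff:
  assumes "i < 4" "j < 4" "i \<noteq> j"
  shows "root4 i j \<in> sl4.radical_roots {0, 2} \<longleftrightarrow> i < 2 \<and> 2 \<le> j"
  using root4_positive_iff[OF assms] root4_levi_iff[OF assms]
  by (auto simp: sl4.radical_roots_def)

section \<open>Levi factor, nilradical and parabolic in blocks of size two\<close>

lemma levi_factor_sl4:
  "sl4.levi_factor {0, 2} = {x \<in> sl4. \<forall>i<4. \<forall>j<4. \<not> (i < 2 \<longleftrightarrow> j < 2) \<longrightarrow> entry x i j = 0}" (is "_ = ?L")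
proof
  have L: "seq.subspace ?L"
    using subspace_sl4 unfolding seq.subspace_def by simp
  have "sl4.weight_space diagonal4 \<beta> \<subseteq> ?L" if "\<beta> \<in> sl4.levi_roots {0, 2}" for \<beta>
  proof -
    have "\<beta> \<in> sl4.root_system diagonal4"
      using that by (simp add: sl4.levi_roots_def)
    then obtain i j where "\<beta> = root4 i j" "i < 4" "j < 4" "i \<noteq> j"
      unfolding root_system_sl4 by blast
    then show ?thesis
      using that root4_levi_iff by (auto simp: weight_space_root4)
  qed
  moreover have "diagonal4 \<subseteq> ?L"
    by (auto simp: diagonal4_def)
  ultimately show "sl4.levi_factor {0, 2} \<subseteq> ?L"
    unfolding sl4.levi_factor_def by (intro seq.span_minimal L) blast
  show "?L \<subseteq> sl4.levi_factor {0, 2}"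
  proof
    fix x assume x: "x \<in> ?L"
    show "x \<in> sl4.levi_factor {0, 2}"
      unfolding sl4.levi_factor_def
    proof (rule mem_subspace_from_entries)
      show "diagonal_part x \<in> seq.span (diagonal4 \<union> (\<Union>\<beta>\<in>sl4.levi_roots {0, 2}. sl4.weight_space diagonal4 \<beta>))"
        using x by (intro seq.span_base UnI1 diagonal_part_diagonal4) simp
      fix i j :: nat assume ij: "i < 4" "j < 4" "i \<noteq> j" "entry x i j \<noteq> 0"
      then have "root4 i j \<in> sl4.levi_roots {0, 2}"
        using x root4_levi_iff by blast
      then show "unit4 i j \<in> seq.span (diagonal4 \<union> (\<Union>\<beta>\<in>sl4.levi_roots {0, 2}. sl4.weight_space diagonal4 \<beta>))"
        using unit4_weight_space ij by (intro seq.span_base UnI2) blast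
    qed (use x sl4_mat4 in auto)
  qed
qed

lemma nilradical_sl4:
  "sl4.nilradical {0, 2} = {x \<in> sl4. \<forall>i<4. \<forall>j<4. \<not> (i < 2 \<and> 2 \<le> j) \<longrightarrow> entry x i j = 0}" (is "_ = ?N")
proof
  have N: "seq.subspace ?N"
    using subspace_sl4 unfolding seq.subspace_def by simp
  have "sl4.weight_space diagonal4 \<beta> \<subseteq> ?N" if "\<beta> \<in> sl4.radical_roots {0, 2}" for \<beta>
  proof -
    have "\<beta> \<in> sl4.root_system diagonal4"
      using that by (simp add: sl4.radical_roots_def sl4.positive_roots_def)
    then obtain i j where "\<beta> = root4 i j" "i < 4" "j < 4" "i \<noteq> j"
      unfolding root_system_sl4 by blast
    then show ?thesis
      using that root4_radical_iff by (auto simp: weight_space_root4)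
  qed
  then show "sl4.nilradical {0, 2} \<subseteq> ?N"
    unfolding sl4.nilradical_def by (intro seq.span_minimal N) blast
  show "?N \<subseteq> sl4.nilradical {0, 2}"
  proof
    fix x assume x: "x \<in> ?N"
    show "x \<in> sl4.nilradical {0, 2}"
      unfolding sl4.nilradical_def
    proof (rule mem_subspace_from_entries)
      have "entry x i i = 0" if "i < 4" for i
        using x that by (metis (mono_tags, lifting) mem_Collect_eq not_le)
      then have "diagonal_part x = 0"
        by (intro mat4_eqI) (auto simp: diagonal_part_def)
      then show "diagonal_part x \<in> seq.span (\<Union>\<beta>\<in>sl4.radical_roots {0, 2}. sl4.weight_space diagonal4 \<beta>)"
        by (simp add: seq.span_zero)
      fix i j :: nat assume ij: "i < 4" "j < 4" "i \<noteq> j" "entry x i j \<noteq> 0"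
      then have "root4 i j \<in> sl4.radical_roots {0, 2}"
        using x root4_radical_iff by blast
      then show "unit4 i j \<in> seq.span (\<Union>\<beta>\<in>sl4.radical_roots {0, 2}. sl4.weight_space diagonal4 \<beta>)"
        using unit4_weight_space ij by (intro seq.span_base) blast
    qed (use x sl4_mat4 in auto)
  qed
qed

lemma parabolic_sl4:
  "sl4.parabolic {0, 2} = {x \<in> sl4. \<forall>i<4. \<forall>j<4. 2 \<le> i \<and> j < 2 \<longrightarrow> entry x i j = 0}" (is "_ = ?P")
proof (intro equalityI subsetI)
  fix z assume "z \<in> sl4.parabolic {0, 2}"
  then obtain x y where z: "z = x + y" and x: "x \<in> sl4.levi_factor {0, 2}" and y: "y \<in> sl4.nilradical {0, 2}"
    unfolding sl4.parabolic_def by blast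
  have "entry x i j = 0 \<and> entry y i j = 0" if "i < 4" "j < 4" "2 \<le> i" "j < 2" for i j
    using x y that not_less[of i 2] unfolding levi_factor_sl4 nilradical_sl4 by blast
  moreover have "z \<in> sl4"
    using x y unfolding z levi_factor_sl4 nilradical_sl4 by (auto intro: seq.subspace_add[OF subspace_sl4])
  ultimately show "z \<in> ?P"
    by (auto simp: z)
next
  fix z assume z: "z \<in> ?P"
  define y where "y = of_entries (\<lambda>i j. if i < 2 \<and> 2 \<le> j then entry z i j else 0)"
  have entry_y: "entry y i j = (if i < 2 \<and> 2 \<le> j then entry z i j else 0)" if "i < 4" "j < 4" for i j
    using that by (simp add: y_def)
  have "y \<in> sl4"
    unfolding sl4_def by (simp add: entry_y sum_less_4) (simp add: y_def)
  then have "y \<in> sl4.nilradical {0, 2}"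
    by (simp add: nilradical_sl4 entry_y)
  moreover have "z - y \<in> sl4.levi_factor {0, 2}"
    using z seq.subspace_diff[OF subspace_sl4 _ \<open>y \<in> sl4\<close>, of z]
    by (auto simp: levi_factor_sl4 entry_y split: if_splits)
  ultimately show "z \<in> sl4.parabolic {0, 2}"
    unfolding sl4.parabolic_def by (metis (mono_tags, lifting) diff_add_cancel mem_Collect_eq)
qed


text \<open>The quotient g/p is the lower left block, on which the two diagonal blocks act by
  multiplication from the left and from the right. One nonzero entry of that block can be moved to
  every other position.\<close>

lemma cominuscule_sl4: "sl4.cominuscule {0, 2}"
  unfolding sl4.cominuscule_def
proof (intro conjI allI impI)
  have "unit4 2 0 \<notin> sl4.parabolic {0, 2}"
    by (auto simp: parabolic_sl4)
  then show "sl4.parabolic {0, 2} \<noteq> sl4"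
    by (metis unit4_sl4 zero_neq_numeral)
next
  fix W assume "seq.subspace W \<and> sl4.parabolic {0, 2} \<subseteq> W \<and> W \<subseteq> sl4 \<and>
    (\<forall>x\<in>sl4.parabolic {0, 2}. \<forall>w\<in>W. sl4_bracket x w \<in> W)"
  then have W: "seq.subspace W" and PW: "sl4.parabolic {0, 2} \<subseteq> W" and "W \<subseteq> sl4"
    and br: "\<And>x w. x \<in> sl4.parabolic {0, 2} \<Longrightarrow> w \<in> W \<Longrightarrow> sl4_bracket x w \<in> W"
    by auto
  have P: "unit4 i j \<in> sl4.parabolic {0, 2}" if "i < 4" "j < 4" "i \<noteq> j" "i < 2 \<or> 2 \<le> j" for i j
    using that by (auto simp: parabolic_sl4)
  show "W = sl4.parabolic {0, 2} \<or> W = sl4"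
  proof (cases "W = sl4.parabolic {0, 2}")
    case False
    then obtain w where "w \<in> W" "w \<notin> sl4.parabolic {0, 2}"
      using PW by blast
    then obtain a b where ab: "a < 4" "b < 4" "2 \<le> a" "b < 2" "entry w a b \<noteq> 0"
      using \<open>W \<subseteq> sl4\<close> unfolding parabolic_sl4 by blast
    \<comment> \<open>The other index of each block: 5 - a exchanges 2 and 3, and 1 - b exchanges 0
      and 1.\<close>
    define a' b' where "a' = 5 - a" and "b' = 1 - b"
    have ab': "a' < 4" "b' < 4" "2 \<le> a'" "b' < 2" "a' \<noteq> a" "b' \<noteq> b"
      using ab(1-4) unfolding a'_def b'_def by presburger+
    define z where "z = of_entries (\<lambda>i j. if 2 \<le> i \<and> j < 2 then entry w i j else 0)"
    have entry_z: "entry z i j = (if 2 \<le> i \<and> j < 2 then entry w i j else 0)" if "i < 4" "j < 4" for i j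
      using that by (simp add: z_def)
    have z: "z \<in> sl4"
      unfolding sl4_def by (simp add: entry_z sum_less_4) (simp add: z_def)
    have "w - z \<in> sl4.parabolic {0, 2}"
      using seq.subspace_diff[OF subspace_sl4 _ z, of w] \<open>w \<in> W\<close> \<open>W \<subseteq> sl4\<close>
      by (auto simp: parabolic_sl4 entry_z)
    then have "w - z \<in> W"
      using PW by blast
    then have "w - (w - z) \<in> W"
      by (rule seq.subspace_diff[OF W \<open>w \<in> W\<close>])
    then have "z \<in> W" by simp
    \<comment> \<open>The inner bracket keeps only column b of z, moved to b'; the outer one keeps
      only row a, moved to a'. A single entry survives.\<close>
    have "seq_scale (- entry w a b) (unit4 a' b') = sl4_bracket (unit4 a' a) (sl4_bracket (unit4 b b') z)"
      using ab ab' by (intro mat4_eqI) (auto simp: entry_z)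
    also have "\<dots> \<in> W"
      using P ab ab' \<open>z \<in> W\<close> by (intro br) auto
    finally have 1: "unit4 a' b' \<in> W"
      using scale_mem_iff[OF W] ab(5) by (metis neg_equal_0_iff_equal)
    have 2: "unit4 i b' \<in> W" if "i < 4" "2 \<le> i" for i
    proof (cases "i = a'")
      case False
      have "unit4 i b' = sl4_bracket (unit4 i a') (unit4 a' b')"
        using that ab' by (intro mat4_eqI) auto
      also have "\<dots> \<in> W"
        using P that ab' False 1 by (intro br) auto
      finally show ?thesis .
    qed (use 1 in simp)
    have 3: "unit4 i j \<in> W" if "i < 4" "j < 4" "2 \<le> i" "j < 2" for i j
    proof (cases "j = b'")
      case False
      have "seq_scale (- 1) (unit4 i j) = sl4_bracket (unit4 b' j) (unit4 i b')"
        using that ab' by (intro mat4_eqI) auto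
      also have "\<dots> \<in> W"
        using P that ab' False 2 by (intro br) auto
      finally show ?thesis
        using scale_mem_iff[OF W] by (metis neg_equal_0_iff_equal zero_neq_one)
    qed (use 2 that in simp)
    have "x \<in> W" if x: "x \<in> sl4" for x
    proof (rule mem_subspace_from_entries[OF sl4_mat4[OF x] W])
      have "diagonal4 \<subseteq> sl4.parabolic {0, 2}"
        unfolding parabolic_sl4 by (auto simp: diagonal4_def)
      then show "diagonal_part x \<in> W"
        using diagonal_part_diagonal4[OF x] PW by blast
      show "unit4 i j \<in> W" if "i < 4" "j < 4" "i \<noteq> j" for i j
        using that 3 P PW by (meson not_le subsetD)
    qed
    then show ?thesis using \<open>W \<subseteq> sl4\<close> by blast
  qed simp
qed

section \<open>Cartan matrix and symmetrizer\<close>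

lemma cartan_matrix_sl4:
  assumes "i < 3" "j < 3"
  shows "sl4.cartan_matrix i j = (if i = j then 2 else if i = Suc j \<or> j = Suc i then - 1 else 0)"
proof -
  have "sl4.root_form (simple_root4 i) (simple_root4 j) =
      (if j = i then 1 else 0) - (if j = Suc i then 1 else 0)
      - ((if Suc j = i then 1 else 0) - (if Suc j = Suc i then 1 else 0))"
    using assms dual_form_root4[of j "Suc j"]
    by (simp add: simple_root4_def root4_weight4[of i "Suc i"])
  moreover have "sl4.root_form (simple_root4 i) (simple_root4 i) = 2"
    using assms by (simp add: simple_root4_def dual_form_root4_self)
  ultimately have "2 * sl4.root_form (simple_root4 i) (simple_root4 j) / sl4.root_form (simple_root4 i) (simple_root4 i)
      = of_int (if i = j then 2 else if i = Suc j \<or> j = Suc i then - 1 else 0)"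
    by auto
  then show ?thesis
    unfolding sl4.cartan_matrix_def by (simp only: of_int_eq_iff the_eq_trivial)
qed

lemma symmetrizer_sl4:
  assumes "i < 3"
  shows "sl4.symmetrizer i = 1"
proof -
  have "sl4.root_form (simple_root4 i) (simple_root4 i) / 2 = of_nat 1"
    using assms by (simp add: simple_root4_def dual_form_root4_self)
  then show ?thesis
    unfolding sl4.symmetrizer_def by (simp only: of_nat_eq_iff the_eq_trivial)
qed


section \<open>The Weyl group\<close>

text \<open>The simple reflection s_i acts on the coordinates of a weight in this way, which turns
  the Weyl group into explicit computation with lists of length 4.\<close>

definition swap_list :: "nat \<Rightarrow> 'a list \<Rightarrow> 'a list" where
  "swap_list i xs = xs[i := xs ! Suc i, Suc i := xs ! i]"

lemma length_swap_list [simp]: "length (swap_list i xs) = length xs"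
  by (simp add: swap_list_def)

lemma length_foldr_swap_list [simp]: "length (foldr swap_list is xs) = length xs"
  by (induction "is") simp_all

lemma map_swap_list: "Suc i < length xs \<Longrightarrow> map f (swap_list i xs) = swap_list i (map f xs)"
  by (simp add: swap_list_def map_update)

lemma map_foldr_swap_list:
  assumes "is \<in> lists {..<3}" "length xs = 4"
  shows "map f (foldr swap_list is xs) = foldr swap_list is (map f xs)"
  using assms by (induction "is") (simp_all add: map_swap_list)

lemma reflection_weight4:
  assumes "i < 3" "length xs = 4"
  shows "sl4.reflection i (weight4 ((!) xs)) = weight4 ((!) (swap_list i xs))"
proof
  fix h
  have form: "sl4.root_form (weight4 ((!) xs)) (simple_root4 i) = xs ! i - xs ! Suc i"
    "sl4.root_form (simple_root4 i) (simple_root4 i) = 2"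
    using assms(1) by (simp_all add: simple_root4_def dual_form_root4 dual_form_root4_self)
  have "i = 0 \<or> i = 1 \<or> i = 2"
    using assms(1) less_3_cases by simp
  then show "sl4.reflection i (weight4 ((!) xs)) h = weight4 ((!) (swap_list i xs)) h"
    unfolding sl4.reflection_def form
    unfolding simple_root4_def
    using assms(2)
    by (elim disjE) (simp_all add: weight4_def root4_def sum_less_4 swap_list_def field_simps eval_nat_numeral)
qed

lemma foldr_reflection_weight4:
  assumes "is \<in> lists {..<3}" "length xs = 4"
  shows "foldr sl4.reflection is (weight4 ((!) xs)) = weight4 ((!) (foldr swap_list is xs))"
  using assms by (induction "is") (simp_all add: reflection_weight4)

lemma weight4_cong: "(\<And>i. i < 4 \<Longrightarrow> c i = c' i) \<Longrightarrow> weight4 c = weight4 c'"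
  by (auto simp: weight4_def fun_eq_iff intro!: sum.cong)

text \<open>Swapping positions commutes with mapping the entries, so the image of this one list
  determines the action of the word on all weights.\<close>

definition word_permutation :: "nat list \<Rightarrow> nat list" where
  "word_permutation is = foldr swap_list is [0, 1, 2, 3]"

lemma foldr_reflection_weight4_permutation:
  assumes "is \<in> lists {..<3}"
  shows "foldr sl4.reflection is (weight4 c) = weight4 ((!) (map c (word_permutation is)))"
proof -
  have "weight4 c = weight4 ((!) (map c [0, 1, 2, 3]))"
    by (rule weight4_cong) (auto simp: less_4_cases)
  moreover have "map c (word_permutation is) = foldr swap_list is (map c [0, 1, 2, 3])"
    unfolding word_permutation_def by (rule map_foldr_swap_list[OF assms]) simp
  ultimately show ?thesis
    using foldr_reflection_weight4[OF assms, of "map c [0, 1, 2, 3]"] by simp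
qed

lemma weyl_word_eqI:
  assumes "is \<in> lists {..<3}" "js \<in> lists {..<3}" "word_permutation is = word_permutation js"
  shows "sl4.weyl_word is = sl4.weyl_word js"
  unfolding sl4.weyl_word_def
proof (rule restrict_ext)
  fix \<mu> assume "\<mu> \<in> sl4.dual_space diagonal4"
  then show "foldr sl4.reflection is \<mu> = foldr sl4.reflection js \<mu>"
    by (rule dual_space_weight4) (simp add: foldr_reflection_weight4_permutation assms)
qed

text \<open>One reduced word for each element, built from coset representatives along
  \<open>S\<^sub>2 \<subset> S\<^sub>3 \<subset> S\<^sub>4\<close>.\<close>

definition normal_words :: "nat list list" where
  "normal_words = [u @ v @ w. u \<leftarrow> [[], [0]], v \<leftarrow> [[], [1], [1, 0]], w \<leftarrow> [[], [2], [2, 1], [2, 1, 0]]]"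

text \<open>Left multiplication by a simple reflection stays within these 24 words up to equality of
  permutations. By induction every element has a word of at most 6 letters.\<close>

lemma normal_words_step:
  "\<forall>w\<in>set normal_words. \<forall>i\<in>{0, 1, 2}. \<exists>w'\<in>set normal_words.
     word_permutation w' = swap_list i (word_permutation w)"
  unfolding normal_words_def word_permutation_def swap_list_def
  by code_simp

lemma normal_words_length: "w \<in> set normal_words \<Longrightarrow> length w \<le> 6 \<and> w \<in> lists {..<3}"
  by (auto simp: normal_words_def)

lemma word_permutation_normal:
  assumes "is \<in> lists {..<3}"
  shows "\<exists>w\<in>set normal_words. word_permutation w = word_permutation is"
  using assms
proof induction
  case Nil
  have "[] \<in> set normal_words" by (simp add: normal_words_def)
  then show ?case by blast
next
  case (Cons i "is")
  then obtain w where w: "w \<in> set normal_words" "word_permutation w = word_permutation is"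
    by blast
  have "word_permutation (i # is) = swap_list i (word_permutation w)"
    unfolding w(2) by (simp add: word_permutation_def)
  moreover have "i \<in> {0, 1, 2}"
    using Cons(1) by auto
  ultimately show ?case
    using normal_words_step w(1) by metis
qed

section \<open>Inversions as a lower bound for the length\<close>

definition inversions :: "nat list \<Rightarrow> nat" where
  "inversions xs = (\<Sum>j<length xs. \<Sum>i<j. if xs ! j < xs ! i then 1 else 0)"

text \<open>Only the comparison between the two swapped neighbours can change.\<close>

lemma inversions_swap_list:
  assumes "length xs = 4" "i < 3"
  shows "inversions (swap_list i xs) \<le> Suc (inversions xs)"
proof -
  obtain a b c d where xs: "xs = [a, b, c, d]"
    using assms(1) by (auto simp: length_Suc_conv eval_nat_numeral)
  have "i = 0 \<or> i = 1 \<or> i = 2"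
    using assms(2) less_3_cases by simp
  then show ?thesis
    by (elim disjE) (auto simp: xs inversions_def swap_list_def eval_nat_numeral)
qed

lemma inversions_word_permutation:
  assumes "is \<in> lists {..<3}"
  shows "inversions (word_permutation is) \<le> length is"
  using assms
proof induction
  case Nil
  show ?case by (simp add: inversions_def word_permutation_def eval_nat_numeral)
next
  case (Cons i "is")
  have "word_permutation (i # is) = swap_list i (word_permutation is)"
    "length (word_permutation is) = 4"
    by (simp_all add: word_permutation_def)
  then show ?case
    using inversions_swap_list[of "word_permutation is" i] Cons by simp
qed

definition longest_word :: "nat list" where
  "longest_word = [1, 2, 1, 0, 1, 2]"

lemma longest_word_lists: "longest_word \<in> lists {..<3}"
  by (simp add: longest_word_def)

lemma word_permutation_longest: "word_permutation longest_word = [3, 2, 1, 0]"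
  by (simp add: word_permutation_def longest_word_def swap_list_def)

text \<open>Coordinates are fixed only up to a common constant, so differences are what an equality
  of weights determines; evaluation at a simple coroot reads them off.\<close>

lemma weight4_eq_differences:
  assumes "weight4 c = weight4 c'" "i < 3"
  shows "c i - c (Suc i) = c' i - c' (Suc i)"
proof -
  have "i = 0 \<or> i = 1 \<or> i = 2"
    using assms(2) less_3_cases by simp
  then show ?thesis
    using fun_cong[OF assms(1), of "unit4 i i - unit4 (Suc i) (Suc i)"] assms(2)
    by (elim disjE) (simp_all add: weight4_def sum_less_4 eval_nat_numeral)
qed

lemma longest_word_length_le:
  assumes "is \<in> lists {..<3}" "sl4.weyl_word is = sl4.weyl_word longest_word"
  shows "6 \<le> length is"
proof -
  obtain a b c d where p: "word_permutation is = [a, b, c, d]"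
  proof -
    have "length (word_permutation is) = 4"
      by (simp add: word_permutation_def)
    then show ?thesis
      using that by (auto simp: length_Suc_conv eval_nat_numeral)
  qed
  \<comment> \<open>The weight with coordinates 0, 1, 2, 3 is regular, so its image recovers the
    permutation up to a shift of all coordinates.\<close>
  have "foldr sl4.reflection is (weight4 of_nat) = foldr sl4.reflection longest_word (weight4 of_nat)"
    using fun_cong[OF assms(2), of "weight4 of_nat"] weight4_dual_space
    by (simp add: sl4.weyl_word_def)
  then have "weight4 ((!) (map of_nat [a, b, c, d])) = weight4 ((!) (map of_nat [3, 2, 1, 0]))"
    by (simp add: foldr_reflection_weight4_permutation assms(1) longest_word_lists p
        word_permutation_longest)
  note diff = weight4_eq_differences[OF this]
  have "of_nat a = (of_nat (Suc b) :: complex)" "of_nat b = (of_nat (Suc c) :: complex)"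
    "of_nat c = (of_nat (Suc d) :: complex)"
    using diff[of 0] diff[of 1] diff[of 2] by (simp_all add: algebra_simps)
  \<comment> \<open>The list is strictly decreasing, and this alone gives all six
    inversions.\<close>
  then have "a = Suc b" "b = Suc c" "c = Suc d"
    by (simp_all only: of_nat_eq_iff)
  then have "inversions (word_permutation is) = 6"
    by (simp add: p inversions_def eval_nat_numeral)
  then show ?thesis
    using inversions_word_permutation[OF assms(1)] by simp
qed

lemma weyl_length_le:
  assumes "is \<in> lists {..<3}"
  shows "sl4.weyl_length (sl4.weyl_word is) \<le> 6"
proof -
  obtain w where w: "w \<in> set normal_words" "word_permutation w = word_permutation is"
    using word_permutation_normal[OF assms] by blast
  then have "w \<in> lists {..<3}" "length w \<le> 6" "sl4.weyl_word w = sl4.weyl_word is"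
    using normal_words_length[OF w(1)] assms by (auto intro: weyl_word_eqI)
  then have "sl4.weyl_length (sl4.weyl_word is) \<le> length w"
    unfolding sl4.weyl_length_def by (intro Least_le) blast
  then show ?thesis using \<open>length w \<le> 6\<close> by simp
qed

lemma weyl_length_longest: "sl4.weyl_length (sl4.weyl_word longest_word) = 6"
  unfolding sl4.weyl_length_def
proof (rule Least_equality)
  show "\<exists>is\<in>lists {..<3}. length is = 6 \<and> sl4.weyl_word is = sl4.weyl_word longest_word"
    using longest_word_lists by (intro bexI[of _ longest_word]) (simp_all add: longest_word_def)
qed (use longest_word_length_le in blast)

lemma longest_element_sl4: "sl4.longest_element (sl4.weyl_word longest_word)"
  unfolding sl4.longest_element_def sl4.weyl_group_def weyl_length_longest
  using longest_word_lists weyl_length_le by blast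

lemma reduced_decomposition_sl4:
  "sl4.reduced_decomposition (sl4.weyl_word longest_word) longest_word"
  unfolding sl4.reduced_decomposition_def weyl_length_longest
  using longest_word_lists by (simp add: longest_word_def)

section \<open>The two radical roots of the counterexample\<close>

lemma root4_list:
  "root4 0 1 = weight4 ((!) [1, - 1, 0, 0])" "root4 2 3 = weight4 ((!) [0, 0, 1, - 1])"
  "root4 1 3 = weight4 ((!) [0, 1, 0, - 1])" "root4 0 3 = weight4 ((!) [1, 0, 0, - 1])"
  by (auto simp: root4_weight4 less_4_cases intro!: weight4_cong)

lemma word_root_longest:
  "sl4.word_root longest_word 1 = root4 1 3" "sl4.word_root longest_word 3 = root4 0 3"
proof -
  have "sl4.word_root longest_word 1 = sl4.reflection 1 (simple_root4 2)"
    by (simp add: sl4.word_root_def longest_word_def)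
  then show "sl4.word_root longest_word 1 = root4 1 3"
    unfolding simple_root4_numeral root4_list by (simp add: reflection_weight4 swap_list_def)
  have "sl4.word_root longest_word 3 = sl4.reflection 1 (sl4.reflection 2 (sl4.reflection 1 (simple_root4 0)))"
    by (simp add: sl4.word_root_def longest_word_def)
  then show "sl4.word_root longest_word 3 = root4 0 3"
    unfolding simple_root4_numeral root4_list by (simp add: reflection_weight4 swap_list_def)
qed

theorem proposition11:
  "\<exists>(\<gg> :: (nat \<Rightarrow> complex) set) bracket H \<kappa> r \<alpha> S w\<^sub>0 is \<xi> \<xi>' k l.
     simple_lie_with_base seq_scale \<gg> bracket H \<kappa> r \<alpha> \<and>
     S \<subseteq> {..<r} \<and>
     simple_lie_with_base.cominuscule seq_scale \<gg> bracket H r \<alpha> S \<and>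
     simple_lie_with_base.longest_element seq_scale H \<kappa> r \<alpha> w\<^sub>0 \<and>
     simple_lie_with_base.reduced_decomposition seq_scale H \<kappa> r \<alpha> w\<^sub>0 is \<and>
     \<xi> \<in> simple_lie_with_base.radical_roots seq_scale \<gg> bracket H r \<alpha> S \<and>
     \<xi>' \<in> simple_lie_with_base.radical_roots seq_scale \<gg> bracket H r \<alpha> S \<and>
     k < length is \<and> simple_lie_with_base.word_root H \<kappa> \<alpha> is k = \<xi> \<and>
     l < length is \<and> simple_lie_with_base.word_root H \<kappa> \<alpha> is l = \<xi>' \<and>
     (let a = simple_lie_with_base.cartan_matrix H \<kappa> \<alpha>;
          d = simple_lie_with_base.symmetrizer H \<kappa> \<alpha>
      in \<forall>q. quantum_parameters.admissible r a d q \<longrightarrow>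
           (\<forall>T\<in>quantum_parameters.lusztig_versions a d q.
              quantum_parameters.uq_class r a d q (commutator (E_root T is k) (F_root T is l))
                \<notin> quantum_parameters.uq_levi r a d q S))"
proof (intro exI conjI)
  show "simple_lie_with_base seq_scale sl4 sl4_bracket diagonal4 trace_form 3 simple_root4"
    by (rule sl4.simple_lie_with_base_axioms)
  show "{0, 2} \<subseteq> {..<3 :: nat}" by simp
  show "sl4.cominuscule {0, 2}" by (rule cominuscule_sl4)
  show "sl4.longest_element (sl4.weyl_word longest_word)" by (rule longest_element_sl4)
  show "sl4.reduced_decomposition (sl4.weyl_word longest_word) longest_word"
    by (rule reduced_decomposition_sl4)
  show "root4 1 3 \<in> sl4.radical_roots {0, 2}" "root4 0 3 \<in> sl4.radical_roots {0, 2}"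
    by (simp_all add: root4_radical_iff)
  show "1 < length longest_word" "3 < length longest_word"
    by (simp_all add: longest_word_def)
  show "sl4.word_root longest_word 1 = root4 1 3" "sl4.word_root longest_word 3 = root4 0 3"
    by (rule word_root_longest)+
  \<comment> \<open>The Cartan data of sl_4 meet the assumptions of \<open>uq_A3\<close> for each
    admissible q, which carries the nonmembership over to the parameters of the statement.\<close>
  have "uq_A3 sl4.cartan_matrix sl4.symmetrizer q"
    if "quantum_parameters.admissible 3 sl4.cartan_matrix sl4.symmetrizer q" for q
    using that cartan_matrix_sl4 symmetrizer_sl4 by unfold_locales
  then show "let a = sl4.cartan_matrix; d = sl4.symmetrizer
    in \<forall>q. quantum_parameters.admissible 3 a d q \<longrightarrow>
      (\<forall>T\<in>quantum_parameters.lusztig_versions a d q.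
         quantum_parameters.uq_class 3 a d q
           (commutator (E_root T longest_word 1) (F_root T longest_word 3))
           \<notin> quantum_parameters.uq_levi 3 a d q {0, 2})"
    unfolding Let_def longest_word_def using uq_A3.commutator_notin_levi by blast
qed

end
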